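(* Let $\Gamma'\subset\Gamma$ be elliptic graphs, $\Gamma'$ a proper connected full subgraph, such that every vertex of $\partial_\Gamma(\Gamma')$ is an end-vertex of $\Gamma'$. Let $\ell'\in Supp_j(P_0^{\Gamma'})$ for some $j$, and suppose the set $\pi^{-1}(\ell'):=\{\ell\in Supp(P_0^\Gamma):\ell|_{\Gamma'}=\ell'\}$ is nonempty. Then $$\sum_{\ell\in\pi^{-1}(\ell')}w^\Gamma(\ell)=w^{\Gamma'}(\ell').$$
   Context: For a decorated tree $G$ (vertex set $\mathcal V(G)$, integer decorations $e_v$, genera zero, negative definite form on $L(G)=\mathbb Z\langle E_v\rangle$ with $(E_v,E_v)=e_v$, $(E_v,E_w)=1$ for adjacent $v\ne w$, $0$ otherwise) let $L'(G)$ be the dual lattice, $[l']$ the class in $L'(G)/L(G)$, $E_v^*$ with $(E_v^*,E_w)=-\delta_{vw}$, $\delta_v$ the valency, $E^G=\sum E_v$, $Z_K^G$ with $(Z_K^G,E_v)=e_v+2$, $\chi(l')=-(l',l'-Z_K^G)/2$; $\ge$ coordinatewise, $\prec$ strict in all coordinates, $l>0$ if $l\ge0,l\ne0$, $|l'|$ the support, $\ell|_{G'}$ restriction of coefficients to the vertices of $G'$. $\mathcal S'(G)=\{l':(l',E_v)\le0\ \forall v\}$, $s_h=\min\{l'\in\mathcal S'(G):[l']=h\}$, $Z_{min}(B)$ the minimal nonzero element of $\mathcal S'(B)\cap L(B)$. $Z^G(\mathbf t)=\sum z^G(l')\mathbf t^{l'}$ is the Taylor expansion at $0$ of $\prod_v(1-\mathbf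 t^{E_v^*})^{\delta_v-2}$. $P_0^G(\mathbf t)=\sum_{\ell\in L(G),\ell\not\prec0}w^G(\ell)\mathbf t^\ell$, $w^G(\ell)=z^G(Z^G_K-E^G-\ell)$; $Supp(P_0^G)=\{\ell\not\prec0:w^G(\ell)\ne0\}$. Elliptic graph: $e_v\le-2$ for all $v$ and $\min_{l\in L(G),l>0}\chi(l)=0$. NN-elliptic sequence: $B^G_{-1}=G$, $Z_{B_{-1}}=s_{[Z^G_K]}$, $B^G_0=|Z^G_K-s_{[Z^G_K]}|$; for $j\ge0$, $Z_{B_j}=Z_{min}(B^G_j)$, and if $Z^G_K-\sum_{i=-1}^jZ_{B_i}\ne0$ then $B^G_{j+1}=|Z^G_K-\sum_{i=-1}^jZ_{B_i}|$; $m$ is the index with $Z^G_K=\sum_{i=-1}^mZ_{B_i}$; $C^G_j=\sum_{i=-1}^jZ_{B_i}$. For $\ell\in Supp(P_0^G)$ with $\mathcal V^{<0}(\ell)=\{v:\ell_v<0\}$, the associated cycle is the unique $l'$ with $\ell=Z^G_K-E^G-l'-\sum_{v\in\mathcal V^{<0}(\ell)}m_vE_v$, $l'\le Z^G_K$, $l'_v=(Z^G_K)_v$ on $\mathcal V^{<0}(\ell)$, $m_v\in\mathbb Z_{\ge0}$; $Supp_j(P_0^G)$ is the set of $\ell$ with associated cycle $C^G_j$. $\partial_\Gamma(\Gamma')$ is the set of vertices of $\Gamma'$ adjacent to a vertex of $\Gamma\setminus\Gamma'$; an end-vertex of $\Gamma'$ has valency 1 in $\Gamma'$. *)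

theory Defs
  imports Complex_Main "HOL-Library.Function_Algebras"
begin

(* A decorated (genus zero) graph is given by a finite vertex set V :: 'a set,
   a symmetric irreflexive adjacency relation adj (only used on V) and integer
   decorations e (only used on V).  A full subgraph on V' \<subseteq> V is given by
   the same adj and e with vertex set V'.
   Cycles l' \<in> L' \<otimes> Q are functions 'a \<Rightarrow> rat vanishing outside V. *)

type_synonym 'a cyc = "'a \<Rightarrow> rat"

definition supported :: "'a set \<Rightarrow> ('a \<Rightarrow> 'b::zero) \<Rightarrow> bool" where
  "supported V x \<longleftrightarrow> (\<forall>v. v \<notin> V \<longrightarrow> x v = 0)"

definition imat :: "('a \<Rightarrow> 'a \<Rightarrow> bool) \<Rightarrow> ('a \<Rightarrow> int) \<Rightarrow> 'a \<Rightarrow> 'a \<Rightarrow> int" where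
  "imat adj e v w = (if v = w then e v else if adj v w then 1 else 0)"

definition form :: "'a set \<Rightarrow> ('a \<Rightarrow> 'a \<Rightarrow> bool) \<Rightarrow> ('a \<Rightarrow> int) \<Rightarrow>
    ('a \<Rightarrow> 'b::comm_ring_1) \<Rightarrow> ('a \<Rightarrow> 'b) \<Rightarrow> 'b" where
  "form V adj e x y = (\<Sum>v\<in>V. \<Sum>w\<in>V. x v * y w * of_int (imat adj e v w))"

definition Ebas :: "'a \<Rightarrow> 'a cyc" where
  "Ebas v = (\<lambda>w. if w = v then 1 else 0)"

definition Eall :: "'a set \<Rightarrow> 'a cyc" where
  "Eall V = (\<lambda>w. if w \<in> V then 1 else 0)"

definition valency :: "'a set \<Rightarrow> ('a \<Rightarrow> 'a \<Rightarrow> bool) \<Rightarrow> 'a \<Rightarrow> nat" where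
  "valency V adj v = card {w \<in> V. adj v w}"

definition is_tree :: "'a set \<Rightarrow> ('a \<Rightarrow> 'a \<Rightarrow> bool) \<Rightarrow> bool" where
  "is_tree V adj \<longleftrightarrow> finite V \<and> V \<noteq> {} \<and>
     (\<forall>u\<in>V. \<forall>v\<in>V. adj u v \<longrightarrow> adj v u) \<and> (\<forall>v\<in>V. \<not> adj v v) \<and>
     (\<forall>u\<in>V. \<forall>v\<in>V. (\<lambda>x y. x \<in> V \<and> y \<in> V \<and> adj x y)\<^sup>*\<^sup>* u v) \<and>
     card {{u, v} | u v. u \<in> V \<and> v \<in> V \<and> adj u v} = card V - 1"

definition neg_definite :: "'a set \<Rightarrow> ('a \<Rightarrow> 'a \<Rightarrow> bool) \<Rightarrow> ('a \<Rightarrow> int) \<Rightarrow> bool" where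
  "neg_definite V adj e \<longleftrightarrow>
     (\<forall>x :: 'a \<Rightarrow> real. supported V x \<longrightarrow> x \<noteq> (\<lambda>_. 0) \<longrightarrow> form V adj e x x < 0)"

definition Lat :: "'a set \<Rightarrow> 'a cyc set" where
  "Lat V = {x. supported V x \<and> (\<forall>v. x v \<in> \<int>)}"

definition Ldual :: "'a set \<Rightarrow> ('a \<Rightarrow> 'a \<Rightarrow> bool) \<Rightarrow> ('a \<Rightarrow> int) \<Rightarrow> 'a cyc set" where
  "Ldual V adj e = {x. supported V x \<and> (\<forall>v\<in>V. form V adj e x (Ebas v) \<in> \<int>)}"

definition Estar :: "'a set \<Rightarrow> ('a \<Rightarrow> 'a \<Rightarrow> bool) \<Rightarrow> ('a \<Rightarrow> int) \<Rightarrow> 'a \<Rightarrow> 'a cyc" where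
  "Estar V adj e v = (THE x. supported V x \<and>
      (\<forall>w\<in>V. form V adj e x (Ebas w) = (if v = w then -1 else 0)))"

definition ZK :: "'a set \<Rightarrow> ('a \<Rightarrow> 'a \<Rightarrow> bool) \<Rightarrow> ('a \<Rightarrow> int) \<Rightarrow> 'a cyc" where
  "ZK V adj e = (THE x. supported V x \<and>
      (\<forall>v\<in>V. form V adj e x (Ebas v) = of_int (e v + 2)))"

definition chi :: "'a set \<Rightarrow> ('a \<Rightarrow> 'a \<Rightarrow> bool) \<Rightarrow> ('a \<Rightarrow> int) \<Rightarrow> 'a cyc \<Rightarrow> rat" where
  "chi V adj e l = - form V adj e l (l - ZK V adj e) / 2"

definition elliptic :: "'a set \<Rightarrow> ('a \<Rightarrow> 'a \<Rightarrow> bool) \<Rightarrow> ('a \<Rightarrow> int) \<Rightarrow> bool" where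
  "elliptic V adj e \<longleftrightarrow> is_tree V adj \<and> neg_definite V adj e \<and> (\<forall>v\<in>V. e v \<le> -2) \<and>
     (\<exists>l\<in>Lat V. l \<ge> (\<lambda>_. 0) \<and> l \<noteq> (\<lambda>_. 0) \<and> chi V adj e l = 0) \<and>
     (\<forall>l\<in>Lat V. l \<ge> (\<lambda>_. 0) \<and> l \<noteq> (\<lambda>_. 0) \<longrightarrow> chi V adj e l \<ge> 0)"

(* coefficient of x^k in (1 - x)^n, n an integer *)
definition bcoeff :: "int \<Rightarrow> nat \<Rightarrow> rat" where
  "bcoeff n k = (-1) ^ k * (of_int n gchoose k)"

(* z^G(l'): coefficient of t^{l'} in the Taylor expansion at 0 of
   prod_v (1 - t^{E_v^*})^(delta_v - 2) *)
definition zcoef :: "'a set \<Rightarrow> ('a \<Rightarrow> 'a \<Rightarrow> bool) \<Rightarrow> ('a \<Rightarrow> int) \<Rightarrow> 'a cyc \<Rightarrow> rat" where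
  "zcoef V adj e l' = (\<Sum>k\<in>{k :: 'a \<Rightarrow> nat. supported V k \<and>
        (\<lambda>u. \<Sum>v\<in>V. of_nat (k v) * Estar V adj e v u) = l'}.
      \<Prod>v\<in>V. bcoeff (int (valency V adj v) - 2) (k v))"

definition wcoef :: "'a set \<Rightarrow> ('a \<Rightarrow> 'a \<Rightarrow> bool) \<Rightarrow> ('a \<Rightarrow> int) \<Rightarrow> 'a cyc \<Rightarrow> rat" where
  "wcoef V adj e l = zcoef V adj e (ZK V adj e - Eall V - l)"

definition SuppP0 :: "'a set \<Rightarrow> ('a \<Rightarrow> 'a \<Rightarrow> bool) \<Rightarrow> ('a \<Rightarrow> int) \<Rightarrow> 'a cyc set" where
  "SuppP0 V adj e = {l \<in> Lat V. \<not> (\<forall>v\<in>V. l v < 0) \<and> wcoef V adj e l \<noteq> 0}"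

definition Sprime :: "'a set \<Rightarrow> ('a \<Rightarrow> 'a \<Rightarrow> bool) \<Rightarrow> ('a \<Rightarrow> int) \<Rightarrow> 'a cyc set" where
  "Sprime V adj e = {x \<in> Ldual V adj e. \<forall>v\<in>V. form V adj e x (Ebas v) \<le> 0}"

definition sZK :: "'a set \<Rightarrow> ('a \<Rightarrow> 'a \<Rightarrow> bool) \<Rightarrow> ('a \<Rightarrow> int) \<Rightarrow> 'a cyc" where
  "sZK V adj e = (THE x. x \<in> Sprime V adj e \<and> x - ZK V adj e \<in> Lat V \<and>
      (\<forall>y\<in>Sprime V adj e. y - ZK V adj e \<in> Lat V \<longrightarrow> x \<le> y))"

definition Zmin :: "'a set \<Rightarrow> ('a \<Rightarrow> 'a \<Rightarrow> bool) \<Rightarrow> ('a \<Rightarrow> int) \<Rightarrow> 'a cyc" where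
  "Zmin B adj e = (THE x. x \<in> Sprime B adj e \<inter> Lat B \<and> x \<noteq> (\<lambda>_. 0) \<and>
      (\<forall>y\<in>Sprime B adj e \<inter> Lat B. y \<noteq> (\<lambda>_. 0) \<longrightarrow> x \<le> y))"

definition csupp :: "'a set \<Rightarrow> 'a cyc \<Rightarrow> 'a set" where
  "csupp V x = {v \<in> V. x v \<noteq> 0}"

(* Cseq V adj e n = C^G_{n-1}: Cseq 0 = Z_{B_{-1}} = s_{[Z_K]},
   Cseq (n+1) = Cseq n + Z_min(|Z_K - Cseq n|) *)
primrec Cseq :: "'a set \<Rightarrow> ('a \<Rightarrow> 'a \<Rightarrow> bool) \<Rightarrow> ('a \<Rightarrow> int) \<Rightarrow> nat \<Rightarrow> 'a cyc" where
  "Cseq V adj e 0 = sZK V adj e"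
| "Cseq V adj e (Suc n) =
     Cseq V adj e n + Zmin (csupp V (ZK V adj e - Cseq V adj e n)) adj e"

definition assoc_cycle :: "'a set \<Rightarrow> ('a \<Rightarrow> 'a \<Rightarrow> bool) \<Rightarrow> ('a \<Rightarrow> int) \<Rightarrow> 'a cyc \<Rightarrow> 'a cyc \<Rightarrow> bool" where
  "assoc_cycle V adj e l l' \<longleftrightarrow> l' \<le> ZK V adj e \<and>
     (\<forall>v\<in>V. l v < 0 \<longrightarrow> l' v = ZK V adj e v) \<and>
     (\<exists>m :: 'a \<Rightarrow> nat. l = ZK V adj e - Eall V - l' -
          (\<lambda>w. if w \<in> V \<and> l w < 0 then of_nat (m w) else 0))"

(* Supp_j(P_0^G), indexed by n = j + 1 *)
definition Suppj :: "'a set \<Rightarrow> ('a \<Rightarrow> 'a \<Rightarrow> bool) \<Rightarrow> ('a \<Rightarrow> int) \<Rightarrow> nat \<Rightarrow> 'a cyc set" where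
  "Suppj V adj e n = {l \<in> SuppP0 V adj e. assoc_cycle V adj e l (Cseq V adj e n)}"

definition restr :: "'a set \<Rightarrow> 'a cyc \<Rightarrow> 'a cyc" where
  "restr V' l = (\<lambda>v. if v \<in> V' then l v else 0)"

end

(* Write x for an integral cycle. Since the E*_v form a basis dual to the E_v, w(x) is a product over the
   vertices of the coefficient of (1 - t)^(valency - 2) in degree valency - 2 + (x, E_v). Sum over
   the values of x outside V' by removing one leaf u of V - V' at a time. The factor at u is
   1/(1 - t), so it is the indicator of a half line x_u < N(x_p), p being the neighbour of u; summing
   over x_u turns the coefficient of (1 - t)^n at p into one of (1 - t)^(n - 1) and replaces the
   linear term at p by a superadditive function. That the indicator stays a half line
   is where ellipticity enters: chi >= 0 on V together with a chi = 0 cycle supported on all of V'.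
   At the end a boundary vertex has exponent valency - 2 = -1, so its factor is 1 as soon as its degree is
   nonnegative, which is what nonemptiness of the fibre guarantees. *)

theory Submission
  imports Defs
begin

section \<open>Linear algebra of the intersection form\<close>

definition nbrs :: "'a set \<Rightarrow> ('a \<Rightarrow> 'a \<Rightarrow> bool) \<Rightarrow> 'a \<Rightarrow> 'a set" where
  "nbrs U adj v = {w \<in> U. adj v w}"

lemma valency_eq: "valency U adj v = card (nbrs U adj v)"
  by (simp add: valency_def nbrs_def)

lemma finite_nbrs [simp]: "finite U \<Longrightarrow> finite (nbrs U adj v)"
  by (simp add: nbrs_def)

definition pairing :: "'a set \<Rightarrow> ('a \<Rightarrow> 'a \<Rightarrow> bool) \<Rightarrow> ('a \<Rightarrow> int) \<Rightarrow> 'a cyc \<Rightarrow> 'a \<Rightarrow> rat" where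
  "pairing V adj e x w = (\<Sum>t\<in>V. x t * of_int (imat adj e t w))"

lemma form_Ebas: "finite V \<Longrightarrow> v \<in> V \<Longrightarrow> form V adj e x (Ebas v) = pairing V adj e x v"
  unfolding form_def pairing_def Ebas_def
  by (intro sum.cong refl) (simp add: if_distrib if_distribR sum.delta cong: if_cong)

lemma form_eq_pairing: "form V adj e x y = (\<Sum>w\<in>V. y w * pairing V adj e x w)"
  unfolding form_def pairing_def
  by (subst sum.swap) (simp add: sum_distrib_left mult_ac)

lemma pairing_add: "pairing V adj e (x + y) w = pairing V adj e x w + pairing V adj e y w"
  by (simp add: pairing_def algebra_simps sum.distrib)

lemma pairing_diff: "pairing V adj e (x - y) w = pairing V adj e x w - pairing V adj e y w"
  by (simp add: pairing_def algebra_simps sum_subtractf)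

lemma pairing_scale: "pairing V adj e (\<lambda>v. a * x v) w = a * pairing V adj e x w"
  by (simp add: pairing_def sum_distrib_left mult_ac)

lemma pairing_sum:
  "finite A \<Longrightarrow> pairing V adj e (\<lambda>u. \<Sum>i\<in>A. a i * f i u) w = (\<Sum>i\<in>A. a i * pairing V adj e (f i) w)"
  unfolding pairing_def
  by (simp add: sum_distrib_right sum_distrib_left mult_ac) (subst sum.swap, simp add: mult_ac)

lemma pairing_Ebas: "finite V \<Longrightarrow> u \<in> V \<Longrightarrow> pairing V adj e (Ebas u) w = of_int (imat adj e u w)"
  by (simp add: pairing_def Ebas_def if_distrib if_distribR sum.delta cong: if_cong)

text \<open>Definiteness is stated for real vectors while cycles are rational; the embedding
  \<open>of_rat\<close> commutes with the form.\<close>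

lemma neg_definite_rat:
  fixes q :: "'a \<Rightarrow> rat"
  assumes "neg_definite V adj e" "supported V q" "q \<noteq> (\<lambda>_. 0)"
  shows "form V adj e q q < 0"
proof -
  let ?r = "\<lambda>v. of_rat (q v) :: real"
  have "supported V ?r" using assms(2) by (simp add: supported_def)
  moreover have "?r \<noteq> (\<lambda>_. 0)" using assms(3) by (auto simp: fun_eq_iff)
  ultimately have "form V adj e ?r ?r < 0"
    using assms(1) by (simp add: neg_definite_def)
  also have "form V adj e ?r ?r = of_rat (form V adj e q q)"
    by (simp add: form_def of_rat_sum of_rat_mult)
  finally show ?thesis by simp
qed

text \<open>Gram-Schmidt over the vertices of \<open>W\<close>. For a new vertex \<open>u\<close>,
  the vector \<open>q = p + Ebas u\<close> is orthogonal to \<open>W\<close> and has coefficient 1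
  at \<open>u\<close>, so its pairing with \<open>u\<close> equals its self-pairing and is negative.
  Adding a multiple of \<open>q\<close> corrects the value at \<open>u\<close> without disturbing
  \<open>W\<close>.\<close>

lemma pairing_solvable:
  assumes nd: "neg_definite V adj e" and V: "finite V" and "W \<subseteq> V"
  shows "\<exists>x. supported W x \<and> (\<forall>w\<in>W. pairing V adj e x w = c w)"
proof -
  have "finite W" using assms by (simp add: finite_subset)
  then show ?thesis using \<open>W \<subseteq> V\<close>
  proof (induction W arbitrary: c rule: finite_induct)
    case empty
    show ?case by (intro exI[of _ "\<lambda>_. 0"]) (simp add: supported_def)
  next
    case (insert u W)
    obtain p where p: "supported W p" "\<And>w. w \<in> W \<Longrightarrow> pairing V adj e p w = - of_int (imat adj e u w)"
      using insert.IH[of "\<lambda>w. - of_int (imat adj e u w)"] insert.prems by auto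
    obtain p' where p': "supported W p'" "\<And>w. w \<in> W \<Longrightarrow> pairing V adj e p' w = c w"
      using insert.IH[of c] insert.prems by auto
    define q where "q = p + Ebas u"
    have u: "u \<in> V" using insert.prems by simp
    have qW: "pairing V adj e q w = 0" if "w \<in> W" for w
      using that p u V by (simp add: q_def pairing_add pairing_Ebas)
    have qu: "q u = 1" using p insert.hyps by (simp add: q_def Ebas_def supported_def)
    have qs: "supported (insert u W) q" using p by (simp add: q_def supported_def Ebas_def)
    have "form V adj e q q < 0"
      using qs qu insert.prems by (intro neg_definite_rat[OF nd]) (auto simp: supported_def)
    also have "form V adj e q q = (\<Sum>w\<in>V. if w = u then pairing V adj e q u else 0)"
      unfolding form_eq_pairing
      using qs qu qW by (intro sum.cong) (auto simp: supported_def)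
    also have "\<dots> = pairing V adj e q u" using u V by simp
    finally have neg: "pairing V adj e q u < 0" .
    define a where "a = (c u - pairing V adj e p' u) / pairing V adj e q u"
    show ?case
    proof (intro exI[of _ "p' + (\<lambda>v. a * q v)"] conjI ballI)
      show "supported (insert u W) (p' + (\<lambda>v. a * q v))"
        using p' qs by (simp add: supported_def)
      fix w assume "w \<in> insert u W"
      then show "pairing V adj e (p' + (\<lambda>v. a * q v)) w = c w"
        using neg p' qW by (auto simp only: pairing_add pairing_scale insert_iff) (simp_all add: a_def)
    qed
  qed
qed

lemma pairing_eq_0_imp:
  assumes "neg_definite V adj e" "supported V x" "\<And>w. w \<in> V \<Longrightarrow> pairing V adj e x w = 0"
  shows "x = (\<lambda>_. 0)"
proof (rule ccontr)
  assume "x \<noteq> (\<lambda>_. 0)"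
  then have "form V adj e x x < 0" using assms by (intro neg_definite_rat)
  then show False using assms(3) by (simp add: form_eq_pairing)
qed

lemma pairing_inj:
  assumes "neg_definite V adj e" "supported V x" "supported V y"
    and "\<And>w. w \<in> V \<Longrightarrow> pairing V adj e x w = pairing V adj e y w"
  shows "x = y"
proof -
  have "x - y = (\<lambda>_. 0)"
    using assms by (intro pairing_eq_0_imp) (auto simp: pairing_diff supported_def)
  then show ?thesis by (simp add: fun_eq_iff)
qed

lemma pairing_solution_unique:
  assumes nd: "neg_definite V adj e" and V: "finite V"
  shows "\<exists>!x. supported V x \<and> (\<forall>w\<in>V. form V adj e x (Ebas w) = c w)"
proof -
  obtain x where x: "supported V x" "\<forall>w\<in>V. pairing V adj e x w = c w"
    using pairing_solvable[OF assms, of V c] by auto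
  show ?thesis
  proof (rule ex1I[of _ x])
    show "supported V x \<and> (\<forall>w\<in>V. form V adj e x (Ebas w) = c w)"
      using x V by (simp add: form_Ebas)
    show "y = x" if "supported V y \<and> (\<forall>w\<in>V. form V adj e y (Ebas w) = c w)" for y
      using that x V by (intro pairing_inj[OF nd]) (auto simp: form_Ebas)
  qed
qed

section \<open>Dual basis, canonical cycle, and the product formula for z and w\<close>

lemma Estar_props:
  assumes nd: "neg_definite V adj e" and V: "finite V"
  shows "supported V (Estar V adj e v)"
    and "w \<in> V \<Longrightarrow> pairing V adj e (Estar V adj e v) w = (if v = w then -1 else 0)"
  using theI'[OF pairing_solution_unique[OF assms, of "\<lambda>w. if v = w then -1 else 0"]] V
  unfolding Estar_def[symmetric] by (auto simp: form_Ebas)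

lemma ZK_props:
  assumes nd: "neg_definite V adj e" and V: "finite V"
  shows "supported V (ZK V adj e)"
    and "w \<in> V \<Longrightarrow> pairing V adj e (ZK V adj e) w = of_int (e w + 2)"
  using theI'[OF pairing_solution_unique[OF assms, of "\<lambda>w. of_int (e w + 2)"]] V
  unfolding ZK_def[symmetric] by (auto simp: form_Ebas)

text \<open>Pairing with E_w reads off -k_w, and the pairings determine a cycle. Hence at most one
  exponent vector contributes to a Taylor coefficient.\<close>

lemma zcoef_index_set:
  assumes nd: "neg_definite V adj e" and V: "finite V" and l: "supported V l"
  shows "{k :: 'a \<Rightarrow> nat. supported V k \<and> (\<lambda>u. \<Sum>v\<in>V. of_nat (k v) * Estar V adj e v u) = l}
       = {k. supported V k \<and> (\<forall>w\<in>V. of_nat (k w) = - pairing V adj e l w)}"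
proof -
  have pk: "pairing V adj e (\<lambda>u. \<Sum>v\<in>V. of_nat (k v) * Estar V adj e v u) w = - of_nat (k w)"
    if "w \<in> V" for k :: "'a \<Rightarrow> nat" and w
  proof -
    have "pairing V adj e (\<lambda>u. \<Sum>v\<in>V. of_nat (k v) * Estar V adj e v u) w
        = (\<Sum>v\<in>V. of_nat (k v) * (if v = w then -1 else 0))"
      unfolding pairing_sum[OF V] using that Estar_props(2)[OF nd V] by simp
    also have "\<dots> = - of_nat (k w)"
      using that V by (simp add: if_distrib sum.delta cong: if_cong)
    finally show ?thesis .
  qed
  have sk: "supported V (\<lambda>u. \<Sum>v\<in>V. of_nat (k v) * Estar V adj e v u)" for k :: "'a \<Rightarrow> nat"
    using Estar_props(1)[OF nd V] by (simp add: supported_def)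
  show ?thesis
  proof (intro Collect_cong conj_cong refl iffI ballI)
    fix k :: "'a \<Rightarrow> nat" and w
    assume "(\<lambda>u. \<Sum>v\<in>V. of_nat (k v) * Estar V adj e v u) = l" "w \<in> V"
    then show "of_nat (k w) = - pairing V adj e l w" using pk[of w k] by simp
  next
    fix k :: "'a \<Rightarrow> nat"
    assume "\<forall>w\<in>V. of_nat (k w) = - pairing V adj e l w"
    then show "(\<lambda>u. \<Sum>v\<in>V. of_nat (k v) * Estar V adj e v u) = l"
      using pk by (intro pairing_inj[OF nd sk l]) (metis minus_minus)
  qed
qed

lemma zcoef_eq:
  assumes nd: "neg_definite V adj e" and V: "finite V" and l: "supported V l"
    and k: "\<And>w. w \<in> V \<Longrightarrow> pairing V adj e l w = - of_int (k w)"
  shows "zcoef V adj e l = (if \<forall>v\<in>V. 0 \<le> k v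
           then \<Prod>v\<in>V. bcoeff (int (valency V adj v) - 2) (nat (k v)) else 0)"
proof (cases "\<forall>v\<in>V. 0 \<le> k v")
  case True
  have "{m :: 'a \<Rightarrow> nat. supported V m \<and> (\<forall>w\<in>V. of_nat (m w) = - pairing V adj e l w)}
      = {\<lambda>v. if v \<in> V then nat (k v) else 0}"
  proof (intro set_eqI iffI; clarsimp)
    fix m :: "'a \<Rightarrow> nat"
    assume m: "supported V m" "\<forall>w\<in>V. rat_of_nat (m w) = - pairing V adj e l w"
    have "m w = nat (k w)" if "w \<in> V" for w
    proof -
      have "rat_of_int (int (m w)) = of_int (k w)" using m(2) k that by simp
      then show ?thesis by (simp only: of_int_eq_iff)
    qed
    then show "m = (\<lambda>v. if v \<in> V then nat (k v) else 0)"
      using m(1) by (auto simp: supported_def)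
  next
    show "supported V (\<lambda>v. if v \<in> V then nat (k v) else 0) \<and>
       (\<forall>w\<in>V. rat_of_nat (nat (k w)) = - pairing V adj e l w)"
      using True k by (auto simp: supported_def)
  qed
  then show ?thesis
    using True by (simp add: zcoef_def zcoef_index_set[OF nd V l] cong: prod.cong)
next
  case False
  then obtain w where w: "w \<in> V" "k w < 0" by auto
  have no: "rat_of_nat (m w) \<noteq> - pairing V adj e l w" for m :: "'a \<Rightarrow> nat"
  proof
    assume "rat_of_nat (m w) = - pairing V adj e l w"
    then have "rat_of_int (int (m w)) = of_int (k w)" using k w by simp
    then show False using w by (simp only: of_int_eq_iff)
  qed
  have E: "{m :: 'a \<Rightarrow> nat. supported V m \<and> (\<forall>w\<in>V. of_nat (m w) = - pairing V adj e l w)} = {}"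
    using no w(1) by blast
  show ?thesis unfolding zcoef_def zcoef_index_set[OF nd V l] E by (simp only: False sum.empty if_False)
qed

text \<open>On a full graph with \<open>g v t = - e v * t\<close>, \<open>idx\<close> is the coefficient of \<open>E\<^sup>*\<^sub>v\<close> in
  \<open>Z\<^sub>K - E - x\<close> and \<open>energy\<close> below is \<open>2 \<chi>\<close>.  Other \<open>g\<close> arise from eliminating leaves.\<close>

definition idx :: "'a set \<Rightarrow> ('a \<Rightarrow> 'a \<Rightarrow> bool) \<Rightarrow> ('a \<Rightarrow> int \<Rightarrow> int) \<Rightarrow> ('a \<Rightarrow> int) \<Rightarrow> 'a \<Rightarrow> int" where
  "idx U adj g x v = int (valency U adj v) - 2 - g v (x v) + (\<Sum>w\<in>nbrs U adj v. x w)"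

definition wt :: "'a set \<Rightarrow> ('a \<Rightarrow> 'a \<Rightarrow> bool) \<Rightarrow> ('a \<Rightarrow> int \<Rightarrow> int) \<Rightarrow> ('a \<Rightarrow> int) \<Rightarrow> rat" where
  "wt U adj g x = (\<Prod>v\<in>U. bcoeff (int (valency U adj v) - 2) (nat (idx U adj g x v)))"

lemma pairing_int:
  assumes "finite V" "w \<in> V" "\<forall>u\<in>V. \<forall>v\<in>V. adj u v \<longrightarrow> adj v u" "\<forall>v\<in>V. \<not> adj v v"
  shows "pairing V adj e (\<lambda>v. of_int (x v)) w = of_int (e w * x w + (\<Sum>t\<in>nbrs V adj w. x t))"
proof -
  have "pairing V adj e (\<lambda>v. of_int (x v)) w
      = (\<Sum>t\<in>V. (if t = w then of_int (e w * x w) else 0) + (if adj w t then of_int (x t) else 0))"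
    unfolding pairing_def using assms by (intro sum.cong) (auto simp: imat_def)
  also have "\<dots> = of_int (e w * x w) + (\<Sum>t\<in>V. if adj w t then of_int (x t) else 0)"
    using assms by (simp add: sum.distrib)
  also have "(\<Sum>t\<in>V. if adj w t then rat_of_int (x t) else 0) = (\<Sum>t\<in>nbrs V adj w. of_int (x t))"
    unfolding nbrs_def using assms(1) by (subst sum.inter_filter) auto
  finally show ?thesis by simp
qed

text \<open>Z_K pairs with E_w to \<open>e w + 2\<close> and E to \<open>e w\<close> plus the
  valency. The \<open>e w\<close> cancel, which leaves degree valency - 2 + (x, E_w).\<close>

lemma wcoef_eq:
  assumes nd: "neg_definite V adj e" and tr: "is_tree V adj" and x: "supported V x"
  shows "wcoef V adj e (\<lambda>v. of_int (x v)) =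
    (if \<forall>v\<in>V. 0 \<le> idx V adj (\<lambda>v t. - e v * t) x v then wt V adj (\<lambda>v t. - e v * t) x else 0)"
  unfolding wcoef_def wt_def
proof (rule zcoef_eq[OF nd])
  have V: "finite V" and s: "\<forall>u\<in>V. \<forall>v\<in>V. adj u v \<longrightarrow> adj v u" "\<forall>v\<in>V. \<not> adj v v"
    using tr by (auto simp: is_tree_def)
  show "finite V" by (fact V)
  show "supported V (ZK V adj e - Eall V - (\<lambda>v. rat_of_int (x v)))"
    using x ZK_props(1)[OF nd V] by (simp add: supported_def Eall_def)
  fix w assume w: "w \<in> V"
  have "Eall V = (\<lambda>v. of_int (if v \<in> V then 1 else 0))" by (auto simp: Eall_def)
  then have "pairing V adj e (Eall V) w = of_int (e w * 1 + (\<Sum>t\<in>nbrs V adj w. if t \<in> V then 1 else 0))"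
    using pairing_int[OF V w s, of e "\<lambda>v. if v \<in> V then 1 else 0"] w by simp
  also have "(\<Sum>t\<in>nbrs V adj w. if t \<in> V then 1 else 0) = (\<Sum>t\<in>nbrs V adj w. (1::int))"
    by (intro sum.cong) (auto simp: nbrs_def)
  finally have "pairing V adj e (Eall V) w = of_int (e w + int (valency V adj w))"
    by (simp add: valency_eq)
  then show "pairing V adj e (ZK V adj e - Eall V - (\<lambda>v. rat_of_int (x v))) w
      = - of_int (idx V adj (\<lambda>v t. - e v * t) x w)"
    using ZK_props(2)[OF nd V w] pairing_int[OF V w s, of e x]
    by (simp add: pairing_diff idx_def)
qed

section \<open>The function chi as an energy\<close>

text \<open>The off-diagonal part of the form: ordered pairs are summed, so each edge counts twice.
  It is used over the integers for energies and over the reals for definiteness.\<close>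

definition esum :: "'a set \<Rightarrow> ('a \<Rightarrow> 'a \<Rightarrow> bool) \<Rightarrow> ('a \<Rightarrow> 'b::comm_ring_1) \<Rightarrow> 'b" where
  "esum U adj y = (\<Sum>v\<in>U. \<Sum>w\<in>nbrs U adj v. y v * y w)"

text \<open>A discrete antiderivative, which replaces the quadratic term of chi once
  \<open>h\<close> is no longer linear. The sum is empty for \<open>x\<close> \<le> 0, so only
  nonnegative arguments carry information.\<close>

definition psum :: "(int \<Rightarrow> int) \<Rightarrow> int \<Rightarrow> int" where
  "psum h x = (\<Sum>t\<in>{0..<x}. h t)"

lemma psum_0 [simp]: "psum h 0 = 0" by (simp add: psum_def)

lemma psum_Suc: "0 \<le> x \<Longrightarrow> psum h (x + 1) = psum h x + h x"
proof -
  assume "0 \<le> x"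
  then have "{0..<x+1} = insert x {0..<x}" by auto
  then show ?thesis by (simp add: psum_def)
qed

lemma psum_1 [simp]: "psum h 1 = h 0" using psum_Suc[of 0 h] by simp

lemma psum_2 [simp]: "psum h 2 = h 0 + h 1" using psum_Suc[of 1 h] by simp

definition energy :: "'a set \<Rightarrow> ('a \<Rightarrow> 'a \<Rightarrow> bool) \<Rightarrow> ('a \<Rightarrow> int \<Rightarrow> int) \<Rightarrow> ('a \<Rightarrow> int) \<Rightarrow> int" where
  "energy U adj g y = 2 * (\<Sum>v\<in>U. y v + psum (g v) (y v)) - esum U adj y"

lemma psum_linear: "0 \<le> x \<Longrightarrow> 2 * psum (\<lambda>t. b * t) x = b * x * (x - 1)"
  by (induction x rule: int_ge_induct) (auto simp: psum_Suc algebra_simps)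

lemma chi_eq_energy:
  assumes nd: "neg_definite V adj e" and tr: "is_tree V adj" and x: "\<forall>v. 0 \<le> x v"
  shows "2 * chi V adj e (\<lambda>v. of_int (x v)) = of_int (energy V adj (\<lambda>v t. - e v * t) x)"
proof -
  have V: "finite V" and s: "\<forall>u\<in>V. \<forall>v\<in>V. adj u v \<longrightarrow> adj v u" "\<forall>v\<in>V. \<not> adj v v"
    using tr by (auto simp: is_tree_def)
  let ?x = "\<lambda>v. rat_of_int (x v)"
  have im: "imat adj e v w = imat adj e w v" if "v \<in> V" "w \<in> V" for v w
    using s that by (auto simp: imat_def)
  have sym: "form V adj e y z = form V adj e z y" for y z :: "'a cyc"
    unfolding form_def by (subst sum.swap) (auto intro!: sum.cong simp: im mult_ac)
  have "2 * chi V adj e ?x = - form V adj e (?x - ZK V adj e) ?x"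
    by (simp add: chi_def sym)
  also have "\<dots> = (\<Sum>w\<in>V. - ?x w * (pairing V adj e ?x w - pairing V adj e (ZK V adj e) w))"
    by (simp add: form_eq_pairing pairing_diff sum_negf)
  also have "\<dots> = (\<Sum>w\<in>V. of_int (2 * (x w + psum (\<lambda>t. - e w * t) (x w)) -
       (\<Sum>t\<in>nbrs V adj w. x w * x t)))"
  proof (intro sum.cong refl)
    fix w assume w: "w \<in> V"
    have "2 * (x w + psum (\<lambda>t. - e w * t) (x w)) = 2 * x w + (- e w) * x w * (x w - 1)"
      using psum_linear[of "x w" "- e w"] x by simp
    then have "2 * (x w + psum (\<lambda>t. - e w * t) (x w)) - (\<Sum>t\<in>nbrs V adj w. x w * x t) =
       - x w * (e w * x w + (\<Sum>t\<in>nbrs V adj w. x t) - (e w + 2))"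
      unfolding sum_distrib_left[symmetric] by (simp add: algebra_simps)
    then show "- ?x w * (pairing V adj e ?x w - pairing V adj e (ZK V adj e) w) =
       of_int (2 * (x w + psum (\<lambda>t. - e w * t) (x w)) - (\<Sum>t\<in>nbrs V adj w. x w * x t))"
      unfolding pairing_int[OF V w s] ZK_props(2)[OF nd V w] by simp
  qed
  also have "\<dots> = of_int (energy V adj (\<lambda>v t. - e v * t) x)"
    by (simp add: energy_def esum_def sum_subtractf sum_distrib_left)
  finally show ?thesis .
qed

lemma esum_insert:
  assumes U: "finite U" "w \<notin> U" and irr: "\<not> adj w w" and sym: "\<forall>v\<in>U. adj v w \<longleftrightarrow> adj w v"
  shows "esum (insert w U) adj y = esum U adj y + 2 * y w * (\<Sum>t\<in>nbrs U adj w. y t)"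
proof -
  have w: "nbrs (insert w U) adj w = nbrs U adj w" using irr by (auto simp: nbrs_def)
  have v: "(\<Sum>t\<in>nbrs (insert w U) adj v. y v * y t) =
     (\<Sum>t\<in>nbrs U adj v. y v * y t) + (if adj w v then y v * y w else 0)" if "v \<in> U" for v
  proof -
    have "nbrs (insert w U) adj v = (if adj w v then insert w (nbrs U adj v) else nbrs U adj v)"
      using sym that by (auto simp: nbrs_def)
    moreover have "w \<notin> nbrs U adj v" using U by (simp add: nbrs_def)
    ultimately show ?thesis using U by simp
  qed
  have "(\<Sum>v\<in>U. if adj w v then y v * y w else 0) = (\<Sum>t\<in>nbrs U adj w. y t * y w)"
    unfolding nbrs_def using U by (subst sum.inter_filter) auto
  then have *: "(\<Sum>v\<in>U. if adj w v then y v * y w else 0) = y w * (\<Sum>t\<in>nbrs U adj w. y t)"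
    by (simp add: sum_distrib_left mult_ac)
  have "esum (insert w U) adj y = y w * (\<Sum>t\<in>nbrs U adj w. y t) +
     (\<Sum>v\<in>U. (\<Sum>t\<in>nbrs U adj v. y v * y t) + (if adj w v then y v * y w else 0))"
    unfolding esum_def using U by (simp add: w v sum_distrib_left)
  also have "\<dots> = esum U adj y + 2 * y w * (\<Sum>t\<in>nbrs U adj w. y t)"
    by (simp add: sum.distrib * esum_def algebra_simps)
  finally show ?thesis .
qed

lemma energy_cong: "(\<And>v. v \<in> U \<Longrightarrow> y v = y' v) \<Longrightarrow> energy U adj g y = energy U adj g y'"
  by (auto simp: energy_def esum_def nbrs_def intro!: sum.cong arg_cong2[where f="(-)"])

lemma esum_cong: "(\<And>v. v \<in> U \<Longrightarrow> y v = y' v) \<Longrightarrow> esum U adj y = esum U adj y'"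
  by (auto simp: esum_def nbrs_def intro!: sum.cong)

lemma energy_insert:
  assumes "finite U" "w \<notin> U" "\<not> adj w w" "\<forall>v\<in>U. adj v w \<longleftrightarrow> adj w v"
  shows "energy (insert w U) adj g y = energy U adj g y
     + 2 * (y w + psum (g w) (y w) - y w * (\<Sum>t\<in>nbrs U adj w. y t))"
  using assms by (simp add: energy_def esum_insert algebra_simps)

lemma energy_subset:
  assumes "finite V" "U \<subseteq> V" "supported U y"
  shows "energy V adj g y = energy U adj g y"
proof -
  have "esum V adj y = (\<Sum>v\<in>U. \<Sum>w\<in>nbrs V adj v. y v * y w)"
    unfolding esum_def using assms
    by (intro sum.mono_neutral_right) (auto simp: supported_def)
  also have "\<dots> = esum U adj y"
    unfolding esum_def using assms
    by (intro sum.cong refl sum.mono_neutral_right) (auto simp: supported_def nbrs_def)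
  finally have "esum V adj y = esum U adj y" .
  moreover have "(\<Sum>v\<in>V. y v + psum (g v) (y v)) = (\<Sum>v\<in>U. y v + psum (g v) (y v))"
    using assms by (intro sum.mono_neutral_right) (auto simp: supported_def)
  ultimately show ?thesis by (simp add: energy_def)
qed

section \<open>A zero-energy witness of full support\<close>

lemma connected_boundary_edge:
  assumes "\<forall>u\<in>V. \<forall>v\<in>V. (\<lambda>x y. x \<in> V \<and> y \<in> V \<and> adj x y)\<^sup>*\<^sup>* u v"
    and "S \<subseteq> V" "S \<noteq> {}" "S \<noteq> V"
  shows "\<exists>s\<in>S. \<exists>w\<in>V - S. adj s w"
proof (rule ccontr)
  assume no: "\<not> ?thesis"
  obtain s t where st: "s \<in> S" "t \<in> V - S" using assms by blast
  have "(\<lambda>x y. x \<in> V \<and> y \<in> V \<and> adj x y)\<^sup>*\<^sup>* s t" using assms st by blast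
  then have "t \<in> S"
    by (induction rule: rtranclp_induct) (use st no in auto)
  then show False using st by simp
qed

text \<open>Raising a zero coefficient to 1 at a vertex adjacent to the support changes the energy
  by 2 (1 - sum of the neighbouring coefficients), which is at most 0. A candidate of maximal
  support is therefore full. Outside \<open>V'\<close> the start is 0 and no coefficient ever
  exceeds 1.\<close>

lemma full_support_energy_le_0:
  assumes tr: "is_tree V adj" and sub: "V' \<subseteq> V"
    and y: "supported V' y" "\<forall>v. 0 \<le> y v" "\<exists>v. y v \<noteq> 0" "energy V' adj g y \<le> 0"
    and g: "\<forall>v\<in>V. g v 0 = 0"
  shows "\<exists>z. (\<forall>v\<in>V. 1 \<le> z v) \<and> (\<forall>v\<in>V-V'. z v = 1) \<and> energy V adj g z \<le> 0"
proof -
  have V: "finite V" and s: "\<forall>u\<in>V. \<forall>v\<in>V. adj u v \<longrightarrow> adj v u" "\<forall>v\<in>V. \<not> adj v v"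
    and con: "\<forall>u\<in>V. \<forall>v\<in>V. (\<lambda>x y. x \<in> V \<and> y \<in> V \<and> adj x y)\<^sup>*\<^sup>* u v"
    using tr by (auto simp: is_tree_def)
  define P where "P z \<longleftrightarrow> (\<forall>v\<in>V. 0 \<le> z v) \<and> (\<exists>v\<in>V. z v \<noteq> 0) \<and> (\<forall>v\<in>V-V'. z v \<le> 1)
      \<and> energy V adj g z \<le> 0" for z :: "'a \<Rightarrow> int"
  define supp where "supp z = {v\<in>V. z v \<noteq> 0}" for z :: "'a \<Rightarrow> int"
  have "P y" unfolding P_def
    using y sub energy_subset[OF V sub, of y adj g] by (force simp: supported_def)
  moreover have "\<forall>z. P z \<longrightarrow> card (supp z) < Suc (card V)"
    using V by (auto simp: supp_def less_Suc_eq_le intro: card_mono)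
  ultimately obtain z where z: "P z" and mx: "\<And>z'. P z' \<Longrightarrow> card (supp z') \<le> card (supp z)"
    using ex_has_greatest_nat[of P y "\<lambda>z. card (supp z)" "Suc (card V)"] by (auto simp: less_imp_le)
  have full: "supp z = V"
  proof (rule ccontr)
    assume "supp z \<noteq> V"
    moreover have "supp z \<subseteq> V" "supp z \<noteq> {}" using z by (auto simp: supp_def P_def)
    ultimately obtain t w where tw: "t \<in> supp z" "w \<in> V - supp z" "adj t w"
      using connected_boundary_edge[OF con] by blast
    define U where "U = V - {w}"
    have VU: "V = insert w U" "w \<notin> U" "finite U" using tw V by (auto simp: U_def)
    have c: "\<not> adj w w" "\<forall>v\<in>U. adj v w \<longleftrightarrow> adj w v" using s VU(1) by auto
    have zw: "z w = 0" using tw by (simp add: supp_def)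
    let ?z = "z(w := 1)"
    have "energy V adj g z = energy U adj g z"
      unfolding VU(1) using VU c zw by (simp add: energy_insert)
    moreover have "energy V adj g ?z = energy U adj g z + 2 * (1 - (\<Sum>t\<in>nbrs U adj w. z t))"
    proof -
      have "energy U adj g ?z = energy U adj g z" using VU by (intro energy_cong) auto
      moreover have "(\<Sum>t\<in>nbrs U adj w. ?z t) = (\<Sum>t\<in>nbrs U adj w. z t)"
        using VU by (intro sum.cong) (auto simp: nbrs_def)
      moreover have "g w 0 = 0" using g VU(1) by simp
      ultimately show ?thesis
        unfolding VU(1) using energy_insert[OF VU(3,2) c, of g ?z] by simp
    qed
    moreover have "1 \<le> (\<Sum>t\<in>nbrs U adj w. z t)"
    proof -
      have "t \<in> nbrs U adj w" using tw s by (auto simp: nbrs_def U_def supp_def)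
      moreover have "\<forall>v\<in>nbrs U adj w. 0 \<le> z v" using z by (auto simp: P_def nbrs_def U_def)
      ultimately have "z t \<le> (\<Sum>t\<in>nbrs U adj w. z t)"
        using VU by (intro member_le_sum) auto
      moreover have "1 \<le> z t" using tw z by (force simp: supp_def P_def)
      ultimately show ?thesis by simp
    qed
    ultimately have "P ?z" using z tw(2) unfolding P_def by auto
    moreover have "supp ?z = insert w (supp z)" using tw by (auto simp: supp_def)
    moreover have "finite (supp z)" "w \<notin> supp z" using V tw by (auto simp: supp_def)
    ultimately show False using mx[of ?z] by simp
  qed
  then have nz: "z v \<noteq> 0" if "v \<in> V" for v using that by (auto simp: supp_def)
  have "\<forall>v\<in>V. 1 \<le> z v" using z nz unfolding P_def by (metis int_one_le_iff_zero_less order_le_less)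
  with z show ?thesis unfolding P_def by (intro exI[of _ z]) (auto intro: antisym)
qed

section \<open>Growing the tree leaf by leaf from the subtree\<close>

inductive built :: "('a \<Rightarrow> 'a \<Rightarrow> bool) \<Rightarrow> 'a set \<Rightarrow> 'a set \<Rightarrow> bool" for adj V' where
  base: "built adj V' V'"
| leaf: "built adj V' U \<Longrightarrow> u \<notin> U \<Longrightarrow> p \<in> U \<Longrightarrow> nbrs (insert u U) adj u = {p} \<Longrightarrow>
    \<forall>v\<in>U. adj v u \<longleftrightarrow> v = p \<Longrightarrow> built adj V' (insert u U)"

lemma card_edges_insert:
  assumes U: "finite U" "w \<notin> U" and irr: "\<not> adj w w" and sym: "\<forall>v\<in>U. adj v w \<longleftrightarrow> adj w v"
  shows "card {{u, v} | u v. u \<in> insert w U \<and> v \<in> insert w U \<and> adj u v}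
       = card {{u, v} | u v. u \<in> U \<and> v \<in> U \<and> adj u v} + card (nbrs U adj w)"
proof -
  let ?E = "{{u, v} | u v. u \<in> U \<and> v \<in> U \<and> adj u v}"
  have "{{u, v} | u v. u \<in> insert w U \<and> v \<in> insert w U \<and> adj u v} = ?E \<union> (\<lambda>t. {w, t}) ` nbrs U adj w"
    using irr sym by (auto simp: nbrs_def)
  moreover have "?E \<inter> (\<lambda>t. {w, t}) ` nbrs U adj w = {}"
    using U by (auto simp: nbrs_def doubleton_eq_iff)
  moreover have "finite ?E"
  proof (rule finite_subset)
    show "?E \<subseteq> Pow U" by auto
  qed (use U in simp)
  moreover have "inj_on (\<lambda>t. {w, t}) (nbrs U adj w)"
    by (auto simp: inj_on_def doubleton_eq_iff)
  ultimately show ?thesis using U by (simp add: card_Un_disjoint card_image)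
qed

text \<open>Attaching an adjacent vertex adds at least one edge. Since edges + 1 = vertices holds
  for both trees, each attached vertex must add exactly one edge, that is, be a leaf at that
  stage.\<close>

lemma built_tree:
  assumes tr: "is_tree V adj" and tr': "is_tree V' adj" and sub: "V' \<subseteq> V"
  shows "built adj V' V"
proof -
  have V: "finite V" and s: "\<forall>u\<in>V. \<forall>v\<in>V. adj u v \<longrightarrow> adj v u" "\<forall>v\<in>V. \<not> adj v v"
    and con: "\<forall>u\<in>V. \<forall>v\<in>V. (\<lambda>x y. x \<in> V \<and> y \<in> V \<and> adj x y)\<^sup>*\<^sup>* u v"
    using tr by (auto simp: is_tree_def)
  define ed where "ed U = card {{u, v} | u v. u \<in> U \<and> v \<in> U \<and> adj u v}" for U
  \<comment> \<open>\<open>built\<close> is only promised when the edge count is minimal, so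
    \<open>R\<close> survives attaching a vertex with several neighbours. The count for
    \<open>V\<close> activates the promise at the end.\<close>
  define R where "R U \<longleftrightarrow> V' \<subseteq> U \<and> U \<subseteq> V \<and> card U \<le> ed U + 1 \<and> (ed U + 1 = card U \<longrightarrow> built adj V' U)" for U
  have ne: "V' \<noteq> {}" "V \<noteq> {}" using tr tr' by (auto simp: is_tree_def)
  have cV: "ed V + 1 = card V" "ed V' + 1 = card V'"
    using tr tr' by (auto simp: is_tree_def ed_def card_gt_0_iff Suc_leI)
  have "R V'" using sub cV(2) by (auto simp: R_def intro: built.base)
  moreover have "\<forall>U. R U \<longrightarrow> card U < Suc (card V)"
    using V by (auto simp: R_def less_Suc_eq_le intro: card_mono)
  ultimately obtain U where U: "R U" and mx: "\<And>U'. R U' \<Longrightarrow> card U' \<le> card U"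
    using ex_has_greatest_nat[of R V' card "Suc (card V)"] by (auto simp: less_imp_le)
  have "U = V"
  proof (rule ccontr)
    assume "U \<noteq> V"
    then obtain t w where tw: "t \<in> U" "w \<in> V - U" "adj t w"
      using connected_boundary_edge[OF con, of U] U ne by (auto simp: R_def)
    have fU: "finite U" "w \<notin> U" using U tw V by (auto simp: R_def intro: finite_subset)
    have c: "\<not> adj w w" "\<forall>v\<in>U. adj v w \<longleftrightarrow> adj w v" using s U tw by (auto simp: R_def)
    have e: "ed (insert w U) = ed U + card (nbrs U adj w)"
      unfolding ed_def by (rule card_edges_insert[OF fU c])
    have tn: "t \<in> nbrs U adj w" using tw c by (auto simp: nbrs_def)
    then have pos: "1 \<le> card (nbrs U adj w)" using fU
      by (metis Suc_leI card_gt_0_iff empty_iff finite_nbrs One_nat_def)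
    have "R (insert w U)" unfolding R_def
    proof (intro conjI impI)
      show "V' \<subseteq> insert w U" "insert w U \<subseteq> V" "card (insert w U) \<le> ed (insert w U) + 1"
        using U tw e pos fU by (auto simp: R_def)
      assume "ed (insert w U) + 1 = card (insert w U)"
      then have c1: "card (nbrs U adj w) = 1" "ed U + 1 = card U"
        using e pos fU U by (auto simp: R_def)
      then have "nbrs U adj w = {t}" using tn by (metis card_1_singletonE singletonD)
      moreover from this have "nbrs (insert w U) adj w = {t}"
        using c(1) by (auto simp: nbrs_def)
      moreover have "\<forall>v\<in>U. adj v w \<longleftrightarrow> v = t"
        using c(2) \<open>nbrs U adj w = {t}\<close> by (auto simp: nbrs_def)
      ultimately show "built adj V' (insert w U)"
        using U c1 fU tw by (intro built.leaf[of _ _ U w t]) (auto simp: R_def)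
    qed
    then show False using mx[of "insert w U"] fU by simp
  qed
  then show ?thesis using U cV by (simp add: R_def)
qed

section \<open>Series coefficients and generalized inverses of superadditive functions\<close>

text \<open>Partial sums of coefficients correspond to multiplication by 1/(1 - t).\<close>

lemma bcoeff_partial_sum: "(\<Sum>j\<le>K. bcoeff n j) = bcoeff (n - 1) K"
  using gbinomial_sum_lower_neg[of "rat_of_int n" K] by (simp add: bcoeff_def mult.commute)

lemma bcoeff_minus_1 [simp]: "bcoeff (-1) k = 1"
  using gbinomial_minus[of "1::rat" k] by (simp add: bcoeff_def flip: power_mult_distrib binomial_gbinomial)

text \<open>A Galois connection: \<open>N c\<close> is the least t with \<open>c\<close> \<le>
  \<open>g t\<close>. For g t = b t with b > 0 this is the ceiling of c/b.\<close>

definition lower_adjoint :: "(int \<Rightarrow> int) \<Rightarrow> (int \<Rightarrow> int) \<Rightarrow> bool" where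
  "lower_adjoint N g \<longleftrightarrow> (\<forall>c t. N c \<le> t \<longleftrightarrow> c \<le> g t)"

lemma superadditive_mult:
  fixes g :: "int \<Rightarrow> int"
  assumes "\<forall>s t. g s + g t \<le> g (s + t)" "g 0 = 0"
  shows "int k * g t \<le> g (int k * t)"
proof (induction k)
  case (Suc k)
  have "int (Suc k) * g t = int k * g t + g t" by (simp add: algebra_simps)
  also have "\<dots> \<le> g (int k * t + t)" using Suc assms(1) by (meson add_right_mono order_trans)
  finally show ?case by (simp add: algebra_simps)
qed (use assms in simp)

text \<open>Superadditivity with \<open>0\<close> \<le> \<open>g 1\<close> makes \<open>g\<close>
  monotone. Multiples of \<open>m\<close> make it unbounded above, and g(-a) \<le> -g(a) makes it
  unbounded below, so each level has a first point where it is reached.\<close>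

lemma ex_lower_adjoint:
  fixes g :: "int \<Rightarrow> int"
  assumes sup: "\<forall>s t. g s + g t \<le> g (s + t)" and g0: "g 0 = 0" and g1: "0 \<le> g 1"
    and m: "1 \<le> g m"
  shows "\<exists>N. lower_adjoint N g"
proof -
  have step: "g t \<le> g (t + 1)" for t using sup[rule_format, of t 1] g1 by simp
  have mono: "g s \<le> g t" if "s \<le> t" for s t
    using that by (induction t rule: int_ge_induct) (use step order_trans in blast)+
  have up: "\<exists>a. c \<le> g a" for c
  proof -
    have "c \<le> int (nat c) * g m" using m mult_left_mono[of 1 "g m" "int (nat c)"] by linarith
    then show ?thesis using superadditive_mult[OF sup g0, of "nat c" m] by (meson order_trans)
  qed
  have down: "\<exists>b. g b < c" for c
  proof -
    obtain a where "1 - c \<le> g a" using up by blast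
    moreover have "g a + g (- a) \<le> 0" using sup[rule_format, of a "- a"] g0 by simp
    ultimately show ?thesis by (intro exI[of _ "- a"]) linarith
  qed
  have "\<exists>n. \<forall>t. n \<le> t \<longleftrightarrow> c \<le> g t" for c
  proof -
    obtain a b where ab: "c \<le> g a" "g b < c" using up down by blast
    define S where "S = {t \<in> {b..a}. c \<le> g t}"
    have "b \<le> a" using ab mono[of a b] by linarith
    then have S: "finite S" "a \<in> S" using ab by (simp_all add: S_def del: atLeastAtMost_iff) simp
    have "Min S \<le> t" if "c \<le> g t" for t
    proof (cases "t \<le> a")
      case True
      moreover have "\<not> t \<le> b" using that ab mono[of t b] by linarith
      ultimately have "t \<in> S" using that by (simp add: S_def)
      then show ?thesis using S by simp
    next
      case False
      then show ?thesis using Min_le[OF S] by linarith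
    qed
    moreover have "c \<le> g t" if "Min S \<le> t" for t
    proof -
      have "Min S \<in> S" using S by (intro Min_in) auto
      then show ?thesis using mono[OF that] by (auto simp: S_def)
    qed
    ultimately show ?thesis by blast
  qed
  then obtain N where "\<forall>c t. N c \<le> t \<longleftrightarrow> c \<le> g t" by metis
  then show ?thesis by (auto simp: lower_adjoint_def)
qed

lemma lower_adjoint_iff: "lower_adjoint N g \<Longrightarrow> N c \<le> t \<longleftrightarrow> c \<le> g t"
  by (simp add: lower_adjoint_def)

lemma lower_adjoint_unit: "lower_adjoint N g \<Longrightarrow> c \<le> g (N c)"
  using lower_adjoint_iff[of N g c "N c"] by simp

lemma lower_adjoint_mono: "lower_adjoint N g \<Longrightarrow> c \<le> d \<Longrightarrow> N c \<le> N d"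
  using lower_adjoint_iff[of N g c "N d"] lower_adjoint_unit[of N g d] by simp

text \<open>Consequently subtracting \<open>N\<close> from a superadditive function leaves it
  superadditive.\<close>

lemma lower_adjoint_subadditive:
  assumes "lower_adjoint N g" "\<forall>s t. g s + g t \<le> g (s + t)"
  shows "N (c + d) \<le> N c + N d"
proof -
  have "c + d \<le> g (N c) + g (N d)" using assms(1) by (intro add_mono lower_adjoint_unit)
  also have "\<dots> \<le> g (N c + N d)" using assms(2) by blast
  finally show ?thesis using assms(1) by (simp add: lower_adjoint_iff)
qed

text \<open>A nonnegative value of \<open>g\<close> at -1 would give a nonnegative value at
  \<open>- m\<close>, contradicting g(m) + g(-m) \<le> 0 < g(m).\<close>

lemma lower_adjoint_0:
  fixes g :: "int \<Rightarrow> int"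
  assumes N: "lower_adjoint N g" and sup: "\<forall>s t. g s + g t \<le> g (s + t)" and g0: "g 0 = 0"
    and m: "1 \<le> g m" "0 \<le> m"
  shows "N 0 = 0"
proof -
  have "N 0 \<le> 0" using N g0 by (simp add: lower_adjoint_iff)
  moreover have "\<not> N 0 \<le> - 1"
  proof
    assume "N 0 \<le> - 1"
    then have "0 \<le> g (- 1)" using N by (simp add: lower_adjoint_iff)
    then have "0 \<le> m * g (- 1)" using m by simp
    then have "0 \<le> g (- m)"
      using superadditive_mult[OF sup g0, of "nat m" "- 1"] m by simp
    moreover have "g m + g (- m) \<le> 0" using sup[rule_format, of m "- m"] g0 by simp
    ultimately show False using m by linarith
  qed
  ultimately show ?thesis by linarith
qed

text \<open>A discrete Legendre (Young) duality: \<open>psum N c\<close> is the maximum over \<open>t\<close> of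
  \<open>c * t - (t + psum g t)\<close>, attained at \<open>t = N c\<close>.\<close>

lemma psum_lower_adjoint:
  assumes N: "lower_adjoint N g" and N0: "N 0 = 0" and c: "0 \<le> c"
  shows "N c + psum g (N c) - N c * c = - psum N c"
  using c
proof (induction c rule: int_ge_induct)
  case (step c)
  have Nc: "0 \<le> N c" using lower_adjoint_mono[OF N step.hyps] N0 by simp
  \<comment> \<open>Between \<open>N c\<close> and \<open>N (c + 1)\<close> the function
    \<open>g\<close> is constantly \<open>c\<close>, so \<open>x + psum g x\<close> has slope
    \<open>c + 1\<close> there.\<close>
  have "x + psum g x = N c + psum g (N c) + (c + 1) * (x - N c)"
    if "N c \<le> x" "x \<le> N (c + 1)" for x
    using that
  proof (induction x rule: int_ge_induct)
    case (step x)
    have "c \<le> g x" using step.hyps N by (simp add: lower_adjoint_iff)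
    moreover have "\<not> c + 1 \<le> g x" using step.prems N by (simp flip: lower_adjoint_iff)
    ultimately have "g x = c" by linarith
    moreover have "psum g (x + 1) = psum g x + g x" using step.hyps Nc by (intro psum_Suc) simp
    ultimately show ?case using step.IH step.prems by (simp add: algebra_simps)
  qed simp
  from this[of "N (c + 1)"] show ?case
    using step lower_adjoint_mono[OF N, of c "c + 1"] psum_Suc[of c N] by (simp add: algebra_simps)
qed (use N0 in simp)

text \<open>Among the \<open>c\<close> summands only the one at 0 vanishes; the others are at least
  1 because \<open>g 0 = 0\<close>. This keeps the energy of the witness nonpositive under
  reduction.\<close>

lemma psum_lower_adjoint_ge:
  assumes N: "lower_adjoint N g" and N0: "N 0 = 0" and g0: "g 0 = 0" and c: "0 \<le> c"
  shows "c - 1 \<le> psum N c"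
  using c
proof (induction c rule: int_ge_induct)
  case (step c)
  have "c = 0 \<or> 1 \<le> N c"
    using lower_adjoint_iff[OF N, of c 0] g0 step.hyps by linarith
  then show ?case using step N0 by (auto simp: psum_Suc)
qed simp

section \<open>Elimination of a single leaf\<close>

lemma psum_diff: "psum (\<lambda>t. f t - h t) x = psum f x - psum h x"
  by (simp add: psum_def sum_subtractf)

text \<open>The invariants of leaf elimination.  The witness \<open>z\<close> forces \<open>0 \<le> g u 1\<close>, hence
  monotonicity of \<open>g u\<close>, at each leaf \<open>u\<close> outside \<open>V'\<close>; the last conjunct, inherited from negative
  definiteness, keeps \<open>g u\<close> unbounded.\<close>

definition tame :: "'a set \<Rightarrow> 'a set \<Rightarrow> ('a \<Rightarrow> 'a \<Rightarrow> bool) \<Rightarrow> ('a \<Rightarrow> int \<Rightarrow> int) \<Rightarrow> bool" where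
  "tame U V' adj g \<longleftrightarrow>
    (\<forall>v\<in>U. g v 0 = 0 \<and> (\<forall>s t. g v s + g v t \<le> g v (s + t))) \<and>
    (\<forall>y. (\<forall>v\<in>U. 0 \<le> y v) \<longrightarrow> 0 \<le> energy U adj g y) \<and>
    (\<exists>z. (\<forall>v\<in>U. 1 \<le> z v) \<and> (\<forall>v\<in>U-V'. z v = 1) \<and> energy U adj g z \<le> 0) \<and>
    (\<exists>(\<beta> :: 'a \<Rightarrow> real) \<kappa>. (\<forall>v\<in>U. \<forall>t\<ge>0. \<beta> v * of_int t - \<kappa> v \<le> of_int (g v t)) \<and>
      (\<forall>y :: 'a \<Rightarrow> real. (\<exists>v\<in>U. y v \<noteq> 0) \<longrightarrow> 0 < (\<Sum>v\<in>U. \<beta> v * (y v)\<^sup>2) - esum U adj y))"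

text \<open>The lattice points over \<open>x'\<close> at which every degree is nonnegative. Outside
  this set the coefficient w vanishes although \<open>wt\<close>, which truncates degrees by
  \<open>nat\<close>, may not.\<close>

definition adm :: "'a set \<Rightarrow> ('a \<Rightarrow> int) \<Rightarrow> 'a set \<Rightarrow> ('a \<Rightarrow> 'a \<Rightarrow> bool) \<Rightarrow> ('a \<Rightarrow> int \<Rightarrow> int)
    \<Rightarrow> ('a \<Rightarrow> int) set" where
  "adm V' x' U adj g = {x. supported U x \<and> (\<forall>v\<in>V'. x v = x' v) \<and> (\<forall>v\<in>U. 0 \<le> idx U adj g x v)}"

locale leaf_extension =
  fixes adj :: "'a \<Rightarrow> 'a \<Rightarrow> bool" and U :: "'a set" and u p :: 'a
  assumes finite_U [simp]: "finite U" and u_notin: "u \<notin> U" and p_in: "p \<in> U"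
    and nbrs_u: "nbrs (insert u U) adj u = {p}" and adj_u: "\<forall>v\<in>U. adj v u \<longleftrightarrow> v = p"
begin

lemma irr: "\<not> adj u u"
proof
  assume "adj u u"
  then have "u \<in> nbrs (insert u U) adj u" by (simp add: nbrs_def)
  then have "u = p" by (simp add: nbrs_u)
  then show False using u_notin p_in by simp
qed

lemma nbrs_U_u: "nbrs U adj u = {p}"
proof -
  have "nbrs (insert u U) adj u = nbrs U adj u" using irr by (auto simp: nbrs_def)
  then show ?thesis by (simp add: nbrs_u)
qed

lemma sym: "\<forall>v\<in>U. adj v u \<longleftrightarrow> adj u v"
proof
  fix v assume v: "v \<in> U"
  have "adj u v \<longleftrightarrow> v \<in> nbrs U adj u" using v by (simp add: nbrs_def)
  then show "adj v u \<longleftrightarrow> adj u v" using adj_u v by (simp add: nbrs_U_u)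
qed

lemma nbrs_insert: "v \<in> U \<Longrightarrow>
    nbrs (insert u U) adj v = (if v = p then insert u (nbrs U adj v) else nbrs U adj v)"
  unfolding nbrs_def using adj_u by auto

lemma u_notin_nbrs: "u \<notin> nbrs U adj v"
  using u_notin by (simp add: nbrs_def)

lemma idx_u: "idx (insert u U) adj g x u = x p - g u (x u) - 1"
  by (simp add: idx_def valency_eq nbrs_u)

lemma valency_insert: "v \<in> U \<Longrightarrow>
    int (valency (insert u U) adj v) = int (valency U adj v) + (if v = p then 1 else 0)"
  by (simp add: valency_eq nbrs_insert u_notin_nbrs)

text \<open>The reduced degree at \<open>p\<close> is the degree for the largest admissible leaf
  value x_u = N(x_p) - 1, where the correction term is 0.\<close>

lemma idx_insert: "v \<in> U \<Longrightarrow> idx (insert u U) adj g x v =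
   idx U adj (g(p := \<lambda>t. g p t - N t)) x v + (if v = p then x u + 1 - N (x p) else 0)"
  by (simp add: idx_def valency_insert) (simp add: nbrs_insert u_notin_nbrs p_in)

lemma idx_upd: "v \<in> U \<Longrightarrow> idx U adj g (x(u := t)) v = idx U adj g x v"
proof -
  assume "v \<in> U"
  moreover have "(\<Sum>w\<in>nbrs U adj v. (x(u := t)) w) = (\<Sum>w\<in>nbrs U adj v. x w)"
    using u_notin_nbrs by (intro sum.cong) auto
  ultimately show ?thesis using u_notin by (auto simp: idx_def simp del: fun_upd_apply) auto
qed

lemma energy_upd: "energy (insert u U) adj g (y(u := t)) =
    energy U adj g y + 2 * (t + psum (g u) t - t * y p)"
proof -
  have "energy U adj g (y(u := t)) = energy U adj g y" 
    using u_notin by (intro energy_cong) auto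
  then show ?thesis
    using energy_insert[OF finite_U u_notin irr sym, of g "y(u := t)"] nbrs_U_u p_in u_notin by auto
qed

lemma energy_reduced: "energy U adj (g(p := \<lambda>t. g p t - N t)) y = energy U adj g y - 2 * psum N (y p)"
proof -
  have "(\<Sum>v\<in>U. y v + psum ((g(p := \<lambda>t. g p t - N t)) v) (y v))
      = (\<Sum>v\<in>U. (y v + psum (g v) (y v)) - (if v = p then psum N (y p) else 0))"
    by (intro sum.cong) (auto simp: psum_diff)
  also have "\<dots> = (\<Sum>v\<in>U. y v + psum (g v) (y v)) - psum N (y p)"
    using p_in by (simp add: sum_subtractf)
  finally show ?thesis by (simp add: energy_def)
qed

text \<open>Over a fixed \<open>y\<close>, the condition at \<open>u\<close> bounds x_u above by
  N(y_p) - 1, and the condition at \<open>p\<close> bounds it below by N(y_p) - 1 minus the reduced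
  degree. The parameter \<open>j\<close> is the degree at \<open>p\<close> in the larger
  graph.\<close>

lemma adm_bij:
  assumes N: "lower_adjoint N (g u)" and V': "V' \<subseteq> U"
  defines "g0 \<equiv> g(p := \<lambda>t. g p t - N t)"
  shows "bij_betw (\<lambda>(y, j). y(u := N (y p) - 1 - idx U adj g0 y p + int j))
    (SIGMA y : adm V' x' U adj g0. {..nat (idx U adj g0 y p)}) (adm V' x' (insert u U) adj g)"
    (is "bij_betw ?f ?S ?T")
proof (rule bij_betw_byWitness[where f' = "\<lambda>x. (x(u := 0), nat (idx (insert u U) adj g x p))"])
  have up: "u \<noteq> p" using u_notin p_in by auto
  have lt: "0 \<le> idx (insert u U) adj g x u \<longleftrightarrow> x u < N (x p)" for x
    using lower_adjoint_iff[OF N, of "x p" "x u"] by (auto simp: idx_u)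
  have ip: "idx (insert u U) adj g x p = idx U adj g0 x p + x u + 1 - N (x p)" for x
    using idx_insert[OF p_in, of g x N] by (simp add: g0_def)
  have iv: "idx (insert u U) adj g x v = idx U adj g0 x v" if "v \<in> U" "v \<noteq> p" for x v
    using idx_insert[OF that(1), of g x N] that by (simp add: g0_def)
  show "\<forall>a\<in>?S. (\<lambda>x. (x(u := 0), nat (idx (insert u U) adj g x p))) (?f a) = a"
    using up u_notin by (auto simp: ip idx_upd p_in adm_def supported_def fun_eq_iff)
  show "\<forall>x\<in>?T. ?f (x(u := 0), nat (idx (insert u U) adj g x p)) = x"
    using up p_in by (auto simp: adm_def idx_upd fun_eq_iff) (auto simp: ip)
  show "?f ` ?S \<subseteq> ?T"
  proof clarify
    fix y j assume y: "y \<in> adm V' x' U adj g0" and j: "j \<le> nat (idx U adj g0 y p)"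
    let ?x = "y(u := N (y p) - 1 - idx U adj g0 y p + int j)"
    have "0 \<le> idx U adj g0 y p" using y p_in by (simp add: adm_def)
    then have "0 \<le> idx (insert u U) adj g ?x u" using j up unfolding lt by auto
    moreover have "0 \<le> idx (insert u U) adj g ?x v" if "v \<in> U" for v
      using y that up by (cases "v = p") (auto simp: ip iv idx_upd adm_def p_in)
    ultimately show "?x \<in> adm V' x' (insert u U) adj g"
      using y V' u_notin by (auto simp: adm_def supported_def)
  qed
  show "(\<lambda>x. (x(u := 0), nat (idx (insert u U) adj g x p))) ` ?T \<subseteq> ?S"
  proof clarify
    fix x assume x: "x \<in> adm V' x' (insert u U) adj g"
    have xu: "x u < N (x p)" using x lt by (simp add: adm_def)
    have "0 \<le> idx U adj g0 x v" if "v \<in> U" for v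
    proof (cases "v = p")
      case True
      have "0 \<le> idx (insert u U) adj g x p" using x p_in by (simp add: adm_def)
      then show ?thesis using xu True unfolding ip by simp
    next
      case False
      then show ?thesis using x that iv[of v x] by (auto simp: adm_def)
    qed
    then have "x(u := 0) \<in> adm V' x' U adj g0"
      using x V' u_notin by (auto simp: adm_def supported_def idx_upd)
    moreover have "idx (insert u U) adj g x p \<le> idx U adj g0 x p" using xu ip[of x] by simp
    ultimately show "x(u := 0) \<in> adm V' x' U adj g0 \<and>
        nat (idx (insert u U) adj g x p) \<in> {..nat (idx U adj g0 (x(u := 0)) p)}"
      using p_in by (simp add: idx_upd nat_mono)
  qed
qed

text \<open>The leaf has exponent -1 and contributes the factor 1. Since \<open>p\<close> has one
  more neighbour in the larger graph, summing its coefficients over \<open>j\<close> lowers the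
  exponent to the one belonging to \<open>U\<close>.\<close>

lemma sum_wt_reduce:
  assumes N: "lower_adjoint N (g u)" and V': "V' \<subseteq> U"
  defines "g0 \<equiv> g(p := \<lambda>t. g p t - N t)"
  assumes fin: "finite (adm V' x' U adj g0)"
  shows "finite (adm V' x' (insert u U) adj g)"
    and "(\<Sum>x\<in>adm V' x' (insert u U) adj g. wt (insert u U) adj g x)
       = (\<Sum>y\<in>adm V' x' U adj g0. wt U adj g0 y)"
proof -
  let ?S = "SIGMA y : adm V' x' U adj g0. {..nat (idx U adj g0 y p)}"
  let ?f = "\<lambda>(y, j). y(u := N (y p) - 1 - idx U adj g0 y p + int j)"
  note bij = adm_bij[where g = g and N = N and x' = x', OF N V', folded g0_def]
  have "finite ?S" using fin by auto
  then show "finite (adm V' x' (insert u U) adj g)" using bij_betw_finite[OF bij] by simp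
  have up: "u \<noteq> p" using u_notin p_in by auto
  define R where "R y = (\<Prod>v\<in>U-{p}. bcoeff (int (valency U adj v) - 2) (nat (idx U adj g0 y v)))" for y
  have wU: "wt U adj g0 y = bcoeff (int (valency U adj p) - 2) (nat (idx U adj g0 y p)) * R y" for y
    unfolding wt_def R_def by (rule prod.remove) (use p_in in auto)
  have wI: "wt (insert u U) adj g x =
    bcoeff (int (valency U adj p) - 1) (nat (idx U adj g0 x p + x u + 1 - N (x p))) * R x" for x
  proof -
    have "int (valency (insert u U) adj u) - 2 = - 1" by (simp add: valency_eq nbrs_u)
    then have "wt (insert u U) adj g x =
      (\<Prod>v\<in>U. bcoeff (int (valency (insert u U) adj v) - 2) (nat (idx (insert u U) adj g x v)))"
      unfolding wt_def using u_notin by simp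
    also have "\<dots> = bcoeff (int (valency (insert u U) adj p) - 2) (nat (idx (insert u U) adj g x p)) *
      (\<Prod>v\<in>U-{p}. bcoeff (int (valency (insert u U) adj v) - 2) (nat (idx (insert u U) adj g x v)))"
      by (rule prod.remove) (use p_in in auto)
    also have "(\<Prod>v\<in>U-{p}. bcoeff (int (valency (insert u U) adj v) - 2) (nat (idx (insert u U) adj g x v))) = R x"
      unfolding R_def g0_def
      by (intro prod.cong refl) (simp add: valency_insert idx_insert[of _ g x N])
    finally show ?thesis
      using p_in by (simp add: valency_insert idx_insert[of _ g x N] g0_def algebra_simps)
  qed
  have R: "R (y(u := t)) = R y" for y t
    unfolding R_def by (intro prod.cong) (auto simp: idx_upd)
  have "(\<Sum>x\<in>adm V' x' (insert u U) adj g. wt (insert u U) adj g x)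
      = (\<Sum>a\<in>?S. wt (insert u U) adj g (?f a))"
    by (rule sum.reindex_bij_betw[OF bij, symmetric])
  also have "\<dots> = (\<Sum>(y, j)\<in>?S. bcoeff (int (valency U adj p) - 1) j * R y)"
    using up by (intro sum.cong refl) (auto simp: wI R idx_upd p_in)
  also have "\<dots> = (\<Sum>y\<in>adm V' x' U adj g0. \<Sum>j\<le>nat (idx U adj g0 y p).
      bcoeff (int (valency U adj p) - 1) j * R y)"
    using fin by (intro sum.Sigma[symmetric]) auto
  also have "\<dots> = (\<Sum>y\<in>adm V' x' U adj g0. wt U adj g0 y)"
    by (simp add: wU bcoeff_partial_sum flip: sum_distrib_right)
  finally show "(\<Sum>x\<in>adm V' x' (insert u U) adj g. wt (insert u U) adj g x)
       = (\<Sum>y\<in>adm V' x' U adj g0. wt U adj g0 y)" .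
qed

lemma adm_nonempty_reduce:
  assumes N: "lower_adjoint N (g u)" and V': "V' \<subseteq> U" and ne: "adm V' x' (insert u U) adj g \<noteq> {}"
  shows "adm V' x' U adj (g(p := \<lambda>t. g p t - N t)) \<noteq> {}"
  using bij_betw_imp_surj_on[OF adm_bij[where g = g and N = N and x' = x', OF N V']] ne by blast

lemma tame_reduce:
  assumes tame: "tame (insert u U) V' adj g" and u: "u \<notin> V'"
  shows "\<exists>N. lower_adjoint N (g u) \<and> tame U V' adj (g(p := \<lambda>t. g p t - N t))"
proof -
  let ?I = "insert u U"
  have up: "u \<noteq> p" using u_notin p_in by auto
  have gv: "\<And>v. v \<in> ?I \<Longrightarrow> g v 0 = 0" "\<And>v. v \<in> ?I \<Longrightarrow> \<forall>s t. g v s + g v t \<le> g v (s + t)"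
    and en: "\<And>y. (\<forall>v\<in>?I. 0 \<le> y v) \<Longrightarrow> 0 \<le> energy ?I adj g y"
    using tame by (auto simp: tame_def)
  obtain z where z: "\<forall>v\<in>?I. 1 \<le> z v" "\<forall>v\<in>?I-V'. z v = 1" "energy ?I adj g z \<le> 0"
    using tame by (auto simp: tame_def)
  obtain \<beta> :: "'a \<Rightarrow> real" and \<kappa>
    where bk: "\<And>v t. v \<in> ?I \<Longrightarrow> 0 \<le> t \<Longrightarrow> \<beta> v * of_int t - \<kappa> v \<le> of_int (g v t)"
    and pd: "\<And>y :: 'a \<Rightarrow> real. (\<exists>v\<in>?I. y v \<noteq> 0) \<Longrightarrow> 0 < (\<Sum>v\<in>?I. \<beta> v * (y v)\<^sup>2) - esum ?I adj y"
    using tame unfolding tame_def by blast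
  have z_upd: "energy ?I adj g z = energy U adj g z + 2 * (1 - z p)"
    using energy_upd[of g z 1] z(2) u gv(1)[of u] by (simp add: fun_upd_idem)
  \<comment> \<open>Raising the leaf coefficient of \<open>z\<close> from 1 to 2 adds 2 (1 + g_u(1)
    - z_p) to a nonpositive energy and must give a nonnegative one. Hence g_u(1) \<ge> z_p - 1 \<ge>
    0.\<close>
  have g1: "0 \<le> g u 1"
  proof -
    have "0 \<le> energy ?I adj g (z(u := 2))" using z(1) by (intro en) force
    also have "\<dots> = energy U adj g z + 2 * (2 + g u 1 - 2 * z p)"
      using gv(1)[of u] by (simp add: energy_upd)
    finally show ?thesis using z(3) z_upd z(1) p_in by auto
  qed
  have quad: "(\<Sum>v\<in>?I. \<beta> v * ((y(u := a)) v)\<^sup>2) - esum ?I adj (y(u := a))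
      = (\<Sum>v\<in>U. \<beta> v * (y v)\<^sup>2) - esum U adj y + \<beta> u * a\<^sup>2 - 2 * a * y p" for y a
  proof -
    have "esum U adj (y(u := a)) = esum U adj y" using u_notin by (intro esum_cong) auto
    moreover have "(\<Sum>v\<in>U. \<beta> v * ((y(u := a)) v)\<^sup>2) = (\<Sum>v\<in>U. \<beta> v * (y v)\<^sup>2)"
      using u_notin by (intro sum.cong) auto
    ultimately show ?thesis
      using esum_insert[of U u adj "y(u := a)"] u_notin irr sym up nbrs_U_u by simp
  qed
  have bu: "0 < \<beta> u"
  proof -
    \<comment> \<open>The test vector is E_u, on which the quadratic form has value
      \<open>\<beta> u\<close>.\<close>
    have "0 < (\<Sum>v\<in>?I. \<beta> v * (((\<lambda>_. 0)(u := 1)) v)\<^sup>2) - esum ?I adj ((\<lambda>_. 0)(u := 1))"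
      by (rule pd) simp
    then show ?thesis unfolding quad by (simp add: esum_def)
  qed
  obtain m :: int where m: "0 \<le> m" "1 \<le> g u m"
  proof -
    \<comment> \<open>Chosen so that the affine lower bound for \<open>g u\<close> is at least 1 at
      \<open>m\<close>.\<close>
    define m where "m = max 0 \<lceil>(\<kappa> u + 1) / \<beta> u\<rceil>"
    have "(\<kappa> u + 1) / \<beta> u \<le> m" unfolding m_def by linarith
    then have "\<kappa> u + 1 \<le> \<beta> u * m" using bu by (simp add: pos_divide_le_eq mult.commute)
    then have "1 \<le> real_of_int (g u m)" using bk[of u m] by (simp add: m_def)
    then show ?thesis using that[of m] by (simp add: m_def)
  qed
  obtain N where N: "lower_adjoint N (g u)"
    using ex_lower_adjoint[of "g u" m] gv g1 m by auto
  have N0: "N 0 = 0" using lower_adjoint_0[OF N] gv m by auto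
  define g0 where "g0 = g(p := \<lambda>t. g p t - N t)"
  have "tame U V' adj g0" unfolding tame_def
  proof (intro conjI ballI allI impI)
    fix v assume v: "v \<in> U"
    show "g0 v 0 = 0" using gv(1)[of v] v N0 by (auto simp: g0_def)
    show "g0 v s + g0 v t \<le> g0 v (s + t)" for s t
    proof -
      have "g v s + g v t \<le> g v (s + t)" using gv(2)[of v] v by blast
      moreover have "N (s + t) \<le> N s + N t"
        using gv(2)[of u] by (intro lower_adjoint_subadditive[OF N]) blast
      ultimately show ?thesis by (auto simp: g0_def)
    qed
  next
    fix y :: "'a \<Rightarrow> int" assume y: "\<forall>v\<in>U. 0 \<le> y v"
    have "0 \<le> N (y p)" using lower_adjoint_mono[OF N, of 0 "y p"] y p_in N0 by simp
    \<comment> \<open>The leaf coefficient \<open>N (y p)\<close> attains the optimum in the Young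
      duality, so the energy of this extension is exactly the reduced energy.\<close>
    then have "0 \<le> energy ?I adj g (y(u := N (y p)))" using y by (intro en) auto
    also have "\<dots> = energy U adj g0 y"
      unfolding energy_upd g0_def energy_reduced
      using psum_lower_adjoint[OF N N0, of "y p"] y p_in by simp
    finally show "0 \<le> energy U adj g0 y" .
  next
    \<comment> \<open>The same witness serves: removing the leaf term 2 (1 - z_p) is compensated by
      the new term -2 \<open>psum N (z p)\<close>.\<close>
    have "z p - 1 \<le> psum N (z p)"
      using psum_lower_adjoint_ge[OF N N0, of "z p"] gv(1)[of u] z(1) p_in by force
    then have "energy U adj g0 z \<le> 0"
      using z_upd z(3) energy_reduced[of g N z] unfolding g0_def by simp
    then show "\<exists>z. (\<forall>v\<in>U. 1 \<le> z v) \<and> (\<forall>v\<in>U - V'. z v = 1) \<and> energy U adj g0 z \<le> 0"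
      using z by blast
  next
    \<comment> \<open>The 1 accounts for testing \<open>g u\<close> at \<open>N t - 1\<close>, the
      last point below level \<open>t\<close>; the other summand absorbs the affine error
      \<open>\<kappa> u\<close>.\<close>
    define K where "K = \<bar>\<kappa> u\<bar> / \<beta> u + 1"
    have NK: "N t \<le> t / \<beta> u + K" if "0 \<le> t" for t :: int
    proof (cases "N t \<le> 0")
      case True
      then have "real_of_int (N t) \<le> 0" by simp
      also have "0 \<le> t / \<beta> u + K" using that bu by (simp add: K_def)
      finally show ?thesis .
    next
      case False
      then have "\<beta> u * of_int (N t - 1) - \<kappa> u \<le> of_int (g u (N t - 1))" by (intro bk) auto
      moreover have "\<not> t \<le> g u (N t - 1)" using lower_adjoint_iff[OF N, of t "N t - 1"] by simp
      ultimately have "\<beta> u * of_int (N t - 1) \<le> t + \<bar>\<kappa> u\<bar>" by linarith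
      then have "of_int (N t - 1) \<le> (t + \<bar>\<kappa> u\<bar>) / \<beta> u" using bu by (simp add: pos_le_divide_eq mult.commute)
      then show ?thesis by (simp add: K_def add_divide_distrib)
    qed
    show "\<exists>(\<beta> :: 'a \<Rightarrow> real) \<kappa>. (\<forall>v\<in>U. \<forall>t\<ge>0. \<beta> v * of_int t - \<kappa> v \<le> of_int (g0 v t)) \<and>
      (\<forall>y :: 'a \<Rightarrow> real. (\<exists>v\<in>U. y v \<noteq> 0) \<longrightarrow> 0 < (\<Sum>v\<in>U. \<beta> v * (y v)\<^sup>2) - esum U adj y)"
    \<comment> \<open>The diagonal entry at \<open>p\<close> becomes that of the Schur complement
      with respect to \<open>u\<close>.\<close>
    proof (rule exI[of _ "\<beta>(p := \<beta> p - 1 / \<beta> u)"], rule exI[of _ "\<kappa>(p := \<kappa> p + K)"],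
        intro conjI ballI allI impI)
      fix v and t :: int assume v: "v \<in> U" and t: "0 \<le> t"
      show "(\<beta>(p := \<beta> p - 1 / \<beta> u)) v * of_int t - (\<kappa>(p := \<kappa> p + K)) v \<le> of_int (g0 v t)"
        using bk[of v t] NK[OF t] v t by (auto simp: g0_def left_diff_distrib)
    next
      fix y :: "'a \<Rightarrow> real" assume "\<exists>v\<in>U. y v \<noteq> 0"
      \<comment> \<open>The coefficient y_p / \<beta>_u minimizes the form in the direction of
        \<open>u\<close>, so positivity passes to the Schur complement.\<close>
      then have "\<exists>v\<in>?I. (y(u := y p / \<beta> u)) v \<noteq> 0" using u_notin by fastforce
      then have "0 < (\<Sum>v\<in>?I. \<beta> v * ((y(u := y p / \<beta> u)) v)\<^sup>2) - esum ?I adj (y(u := y p / \<beta> u))"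
        by (rule pd)
      also have "\<dots> = (\<Sum>v\<in>U. \<beta> v * (y v)\<^sup>2) - (y p)\<^sup>2 / \<beta> u - esum U adj y"
        unfolding quad using bu by (simp add: power2_eq_square)
      also have "(\<Sum>v\<in>U. \<beta> v * (y v)\<^sup>2) - (y p)\<^sup>2 / \<beta> u =
          (\<Sum>v\<in>U. \<beta> v * (y v)\<^sup>2 - (if v = p then (y p)\<^sup>2 / \<beta> u else 0))"
        using p_in by (simp add: sum_subtractf)
      also have "\<dots> = (\<Sum>v\<in>U. (\<beta>(p := \<beta> p - 1 / \<beta> u)) v * (y v)\<^sup>2)"
        by (intro sum.cong) (auto simp: left_diff_distrib)
      finally show "0 < (\<Sum>v\<in>U. (\<beta>(p := \<beta> p - 1 / \<beta> u)) v * (y v)\<^sup>2) - esum U adj y" .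
    qed
  qed
  then show ?thesis using N unfolding g0_def by blast
qed

end

section \<open>Elimination of all vertices outside the subgraph\<close>

lemma built_subset: "built adj V' U \<Longrightarrow> V' \<subseteq> U"
  by (induction rule: built.induct) auto

lemma built_finite: "built adj V' U \<Longrightarrow> finite V' \<Longrightarrow> finite U"
  by (induction rule: built.induct) auto

text \<open>Reduction alters \<open>g\<close> only at the neighbour of the removed leaf, so vertices
  of \<open>V'\<close> with no neighbour outside \<open>V'\<close> keep their function. Nonemptiness
  is carried along to control the degrees at the boundary at the end.\<close>

lemma eliminate_leaves:
  assumes "built adj V' U" "finite V'" "tame U V' adj g"
  shows "\<exists>h. (\<forall>v\<in>V'. (\<forall>u\<in>U-V'. \<not> adj v u) \<longrightarrow> h v = g v) \<and>
    (adm V' x' U adj g \<noteq> {} \<longrightarrow> adm V' x' V' adj h \<noteq> {}) \<and> finite (adm V' x' U adj g) \<and>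
    (\<Sum>x\<in>adm V' x' U adj g. wt U adj g x) = (\<Sum>x\<in>adm V' x' V' adj h. wt V' adj h x)"
  using assms
proof (induction arbitrary: g rule: built.induct)
  case base
  have "adm V' x' V' adj g \<subseteq> {\<lambda>v. if v \<in> V' then x' v else 0}"
    by (auto simp: adm_def supported_def)
  then have "finite (adm V' x' V' adj g)" by (rule finite_subset) simp
  then show ?case by blast
next
  case (leaf U u p)
  interpret leaf_extension adj U u p
    using leaf built_finite[OF leaf.hyps(1)] by unfold_locales auto
  have V': "V' \<subseteq> U" using leaf.hyps(1) by (rule built_subset)
  then have u: "u \<notin> V'" using leaf.hyps by auto
  obtain N where N: "lower_adjoint N (g u)" and tame: "tame U V' adj (g(p := \<lambda>t. g p t - N t))"
    using tame_reduce[OF leaf.prems(2) u] by blast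
  define g0 where "g0 = g(p := \<lambda>t. g p t - N t)"
  obtain h where h: "\<forall>v\<in>V'. (\<forall>u\<in>U-V'. \<not> adj v u) \<longrightarrow> h v = g0 v"
    "adm V' x' U adj g0 \<noteq> {} \<longrightarrow> adm V' x' V' adj h \<noteq> {}" "finite (adm V' x' U adj g0)"
    "(\<Sum>x\<in>adm V' x' U adj g0. wt U adj g0 x) = (\<Sum>x\<in>adm V' x' V' adj h. wt V' adj h x)"
    using leaf.IH[OF leaf.prems(1) tame] unfolding g0_def by blast
  have "h v = g v" if "v \<in> V'" "\<forall>w\<in>insert u U - V'. \<not> adj v w" for v
  proof -
    have "\<not> adj v u" using that(2) u by blast
    \<comment> \<open>\<open>p\<close> is adjacent to the outside vertex \<open>u\<close>, so an
      interior vertex of \<open>V'\<close> differs from it.\<close>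
    then have "v \<noteq> p" using adj_u p_in by blast
    then show ?thesis using h(1) that by (auto simp: g0_def)
  qed
  then show ?case
    using h sum_wt_reduce[where g = g and N = N and x' = x', OF N V', folded g0_def]
      adm_nonempty_reduce[where g = g and N = N and x' = x', OF N V', folded g0_def]
    by (intro exI[of _ h]) auto
qed

section \<open>Elliptic graphs satisfy the invariants\<close>

lemma form_real_eq:
  fixes y :: "'a \<Rightarrow> real"
  assumes "finite V" "\<forall>v\<in>V. \<not> adj v v"
  shows "form V adj e y y = (\<Sum>v\<in>V. of_int (e v) * (y v)\<^sup>2) + esum V adj y"
proof -
  have "(\<Sum>w\<in>V. y v * y w * of_int (imat adj e v w))
      = of_int (e v) * (y v)\<^sup>2 + (\<Sum>w\<in>nbrs V adj v. y v * y w)" if v: "v \<in> V" for v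
  proof -
    have "(\<Sum>w\<in>V. y v * y w * of_int (imat adj e v w))
      = (\<Sum>w\<in>V. (if w = v then of_int (e v) * (y v)\<^sup>2 else 0) + (if adj v w then y v * y w else 0))"
      using assms v by (intro sum.cong) (auto simp: imat_def power2_eq_square)
    also have "\<dots> = of_int (e v) * (y v)\<^sup>2 + (\<Sum>w\<in>V. if adj v w then y v * y w else 0)"
      using assms v by (simp add: sum.distrib)
    also have "(\<Sum>w\<in>V. if adj v w then y v * y w else 0) = (\<Sum>w\<in>nbrs V adj v. y v * y w)"
      unfolding nbrs_def using assms(1) by (subst sum.inter_filter) auto
    finally show ?thesis .
  qed
  then show ?thesis by (simp add: form_def esum_def sum.distrib)
qed

lemma Lat_int:
  assumes "x \<in> Lat V"
  obtains y :: "'a \<Rightarrow> int" where "supported V y" "x = (\<lambda>v. of_int (y v))"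
proof (rule that)
  show "x = (\<lambda>v. of_int \<lfloor>x v\<rfloor>)" using assms by (auto simp: Lat_def Ints_def)
  show "supported V (\<lambda>v. \<lfloor>x v\<rfloor>)" using assms by (simp add: Lat_def supported_def)
qed

text \<open>Nonnegativity of the energy comes from ellipticity on \<open>V\<close>. The witness
  starts from a chi = 0 cycle on \<open>V'\<close> rather than on \<open>V\<close>, which is why its
  coefficients outside \<open>V'\<close> equal 1. Negative definiteness supplies
  \<open>\<beta> = - e\<close> and \<open>\<kappa> = 0\<close>.\<close>

lemma elliptic_tame:
  assumes ell: "elliptic V adj e" and ell': "elliptic V' adj e" and sub: "V' \<subseteq> V"
  shows "tame V V' adj (\<lambda>v t. - e v * t)" (is "tame V V' adj ?g")
proof -
  have tr: "is_tree V adj" and nd: "neg_definite V adj e"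
    and tr': "is_tree V' adj" and nd': "neg_definite V' adj e"
    using ell ell' by (auto simp: elliptic_def)
  have V: "finite V" and irr: "\<forall>v\<in>V. \<not> adj v v" using tr by (auto simp: is_tree_def)
  have nonneg: "0 \<le> energy V adj ?g y" if y: "\<forall>v\<in>V. 0 \<le> y v" for y
  proof -
    define x where "x v = (if v \<in> V then y v else 0)" for v
    have x: "supported V x" "\<forall>v. 0 \<le> x v" using y by (auto simp: x_def supported_def)
    have "0 \<le> energy V adj ?g x"
    proof (cases "x = (\<lambda>_. 0)")
      case True
      then show ?thesis by (simp add: energy_def esum_def)
    next
      case False
      let ?l = "\<lambda>v. rat_of_int (x v)"
      have "?l \<in> Lat V" "?l \<ge> (\<lambda>_. 0)" "?l \<noteq> (\<lambda>_. 0)"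
        using x False by (auto simp: Lat_def supported_def le_fun_def fun_eq_iff)
      then have "0 \<le> 2 * chi V adj e ?l" using ell by (simp add: elliptic_def)
      then show ?thesis using chi_eq_energy[OF nd tr x(2)] by simp
    qed
    also have "energy V adj ?g x = energy V adj ?g y" by (rule energy_cong) (simp add: x_def)
    finally show ?thesis .
  qed
  obtain l where l: "l \<in> Lat V'" "l \<ge> (\<lambda>_. 0)" "l \<noteq> (\<lambda>_. 0)" "chi V' adj e l = 0"
    using ell' by (auto simp: elliptic_def)
  obtain y :: "'a \<Rightarrow> int" where y: "supported V' y" "l = (\<lambda>v. of_int (y v))"
    using Lat_int[OF l(1)] by blast
  have y0: "\<forall>v. 0 \<le> y v" "\<exists>v. y v \<noteq> 0" using l y by (auto simp: le_fun_def)
  have "energy V' adj ?g y \<le> 0" using chi_eq_energy[OF nd' tr' y0(1)] l(4) y(2) by simp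
  then have witness: "\<exists>z. (\<forall>v\<in>V. 1 \<le> z v) \<and> (\<forall>v\<in>V-V'. z v = 1) \<and> energy V adj ?g z \<le> 0"
    using full_support_energy_le_0[OF tr sub y(1) y0] by simp
  have pos: "0 < (\<Sum>v\<in>V. - of_int (e v) * (y v)\<^sup>2) - esum V adj y"
    if "\<exists>v\<in>V. y v \<noteq> 0" for y :: "'a \<Rightarrow> real"
  proof -
    define x where "x v = (if v \<in> V then y v else 0)" for v
    have "supported V x" "x \<noteq> (\<lambda>_. 0)" using that by (auto simp: x_def supported_def fun_eq_iff)
    then have "form V adj e x x < 0" using nd by (simp add: neg_definite_def)
    then have "(\<Sum>v\<in>V. of_int (e v) * (x v)\<^sup>2) + esum V adj x < 0"
      using form_real_eq[where adj = adj, OF V irr] by simp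
    moreover have "esum V adj x = esum V adj y" by (rule esum_cong) (simp add: x_def)
    moreover have "(\<Sum>v\<in>V. of_int (e v) * (x v)\<^sup>2) = (\<Sum>v\<in>V. of_int (e v) * (y v)\<^sup>2)"
      by (rule sum.cong) (auto simp: x_def)
    ultimately show ?thesis by (simp add: sum_negf)
  qed
  have "\<exists>(\<beta> :: 'a \<Rightarrow> real) \<kappa>. (\<forall>v\<in>V. \<forall>t\<ge>0. \<beta> v * of_int t - \<kappa> v \<le> of_int (?g v t)) \<and>
      (\<forall>y :: 'a \<Rightarrow> real. (\<exists>v\<in>V. y v \<noteq> 0) \<longrightarrow> 0 < (\<Sum>v\<in>V. \<beta> v * (y v)\<^sup>2) - esum V adj y)"
    by (rule exI[of _ "\<lambda>v. - of_int (e v)"], rule exI[of _ "\<lambda>_. 0"]) (use pos in auto)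
  moreover have "\<forall>v\<in>V. ?g v 0 = 0 \<and> (\<forall>s t. ?g v s + ?g v t \<le> ?g v (s + t))"
    by (simp add: algebra_simps)
  ultimately show ?thesis
    unfolding tame_def using nonneg witness by blast
qed

lemma idx_cong:
  assumes "\<And>w. w \<in> U \<Longrightarrow> x w = y w" "v \<in> U" "g v = h v"
  shows "idx U adj g x v = idx U adj h y v"
proof -
  have "(\<Sum>w\<in>nbrs U adj v. x w) = (\<Sum>w\<in>nbrs U adj v. y w)"
    using assms by (intro sum.cong) (auto simp: nbrs_def)
  then show ?thesis using assms by (simp add: idx_def)
qed

section \<open>The sum over the fibre\<close>

theorem mainTheorem8:
  fixes V V' :: "'a set" and adj :: "'a \<Rightarrow> 'a \<Rightarrow> bool" and e :: "'a \<Rightarrow> int"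
    and l' :: "'a \<Rightarrow> rat" and n :: nat
  assumes ellG: "elliptic V adj e"
    and ellG': "elliptic V' adj e"
    and sub: "V' \<subset> V"
    and bdry: "\<forall>v\<in>V'. (\<exists>u\<in>V - V'. adj v u) \<longrightarrow> valency V' adj v = 1"
    and jrange: "\<forall>i<n. Cseq V' adj e i \<noteq> ZK V' adj e"
    and inj: "l' \<in> Suppj V' adj e n"
    and nonempty: "{l \<in> SuppP0 V adj e. restr V' l = l'} \<noteq> {}"
  shows "(\<Sum>l\<in>{l \<in> SuppP0 V adj e. restr V' l = l'}. wcoef V adj e l) = wcoef V' adj e l'"
proof -
  have tr: "is_tree V adj" and nd: "neg_definite V adj e"
    and tr': "is_tree V' adj" and nd': "neg_definite V' adj e"
    using ellG ellG' by (auto simp: elliptic_def)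
  have V': "finite V'" "V' \<subseteq> V" using tr' sub by (auto simp: is_tree_def)
  define g where "g = (\<lambda>v t. - e v * t)"
  have l': "l' \<in> Lat V'" "\<exists>v\<in>V'. 0 \<le> l' v" "wcoef V' adj e l' \<noteq> 0"
    using inj by (auto simp: Suppj_def SuppP0_def not_less)
  obtain x' where x': "supported V' x'" "l' = (\<lambda>v. of_int (x' v))" using Lat_int[OF l'(1)] by blast
  have w': "\<forall>v\<in>V'. 0 \<le> idx V' adj g x' v" "wcoef V' adj e l' = wt V' adj g x'"
    using wcoef_eq[OF nd' tr' x'(1), folded g_def] l'(3) unfolding x'(2) by (auto split: if_splits)
  \<comment> \<open>The fibre in integer coordinates. Points of vanishing weight are removed because
    they are not in the support of P_0; they return in the sum below as zero terms.\<close>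
  define A where "A = {x \<in> adm V' x' V adj g. wt V adj g x \<noteq> 0}"
  define \<iota> where "\<iota> = (\<lambda>(x :: 'a \<Rightarrow> int) v. rat_of_int (x v))"
  have w: "wcoef V adj e (\<iota> x) = wt V adj g x" if "x \<in> adm V' x' V adj g" for x
    using that wcoef_eq[OF nd tr, of x, folded g_def] by (simp add: adm_def \<iota>_def)
  have "{l \<in> SuppP0 V adj e. restr V' l = l'} = \<iota> ` A"
  proof (intro equalityI subsetI)
    fix l assume l: "l \<in> {l \<in> SuppP0 V adj e. restr V' l = l'}"
    then have "l \<in> Lat V" by (simp add: SuppP0_def)
    then obtain x where x: "supported V x" "l = (\<lambda>v. of_int (x v))" using Lat_int by blast
    have "wcoef V adj e (\<lambda>v. of_int (x v)) \<noteq> 0" using l x(2) by (simp add: SuppP0_def)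
    then have "\<forall>v\<in>V. 0 \<le> idx V adj g x v" "wt V adj g x \<noteq> 0"
      using wcoef_eq[OF nd tr x(1), folded g_def] by (auto split: if_splits)
    moreover have "x v = x' v" if "v \<in> V'" for v
    proof -
      have "restr V' l v = l' v" using l by simp
      then show ?thesis using that x(2) x'(2) by (simp add: restr_def)
    qed
    ultimately have "x \<in> A" using x(1) by (simp add: A_def adm_def)
    then show "l \<in> \<iota> ` A" using x(2) by (auto simp: \<iota>_def)
  next
    fix l assume "l \<in> \<iota> ` A"
    then obtain x where x: "x \<in> A" "l = \<iota> x" by blast
    then have adm: "x \<in> adm V' x' V adj g" and "wt V adj g x \<noteq> 0" by (auto simp: A_def)
    then have "wcoef V adj e l \<noteq> 0" using x(2) w by simp
    moreover have "l \<in> Lat V" using adm x(2) by (simp add: Lat_def adm_def supported_def \<iota>_def)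
    moreover have r: "restr V' l = l'"
      using adm x' x(2) by (auto simp: restr_def adm_def \<iota>_def supported_def)
    \<comment> \<open>A nonnegative coordinate of \<open>l'\<close> is also one of \<open>l\<close>,
      so no lift has all coordinates negative.\<close>
    moreover have "\<not> (\<forall>v\<in>V. l v < 0)"
    proof -
      obtain v where v: "v \<in> V'" "0 \<le> l' v" using l'(2) by blast
      then have "0 \<le> l v" unfolding r[symmetric] by (simp add: restr_def)
      then show ?thesis using v V' by (auto simp: not_less)
    qed
    ultimately show "l \<in> {l \<in> SuppP0 V adj e. restr V' l = l'}" by (simp add: SuppP0_def)
  qed
  moreover have "inj_on \<iota> A" by (auto simp: inj_on_def \<iota>_def fun_eq_iff)
  ultimately have "(\<Sum>l\<in>{l \<in> SuppP0 V adj e. restr V' l = l'}. wcoef V adj e l)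
      = (\<Sum>x\<in>A. wcoef V adj e (\<iota> x))" and ne: "A \<noteq> {}"
    using nonempty by (auto simp: sum.reindex)
  note this(1)
  also have "(\<Sum>x\<in>A. wcoef V adj e (\<iota> x)) = (\<Sum>x\<in>A. wt V adj g x)"
    using w by (intro sum.cong) (auto simp: A_def)
  finally have 1: "(\<Sum>l\<in>{l \<in> SuppP0 V adj e. restr V' l = l'}. wcoef V adj e l) = (\<Sum>x\<in>A. wt V adj g x)" .
  obtain h where h: "\<forall>v\<in>V'. (\<forall>u\<in>V-V'. \<not> adj v u) \<longrightarrow> h v = g v"
    "adm V' x' V adj g \<noteq> {} \<longrightarrow> adm V' x' V' adj h \<noteq> {}" "finite (adm V' x' V adj g)"
    "(\<Sum>x\<in>adm V' x' V adj g. wt V adj g x) = (\<Sum>x\<in>adm V' x' V' adj h. wt V' adj h x)"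
    using eliminate_leaves[OF built_tree[OF tr tr' V'(2)] V'(1), of g x']
      elliptic_tame[OF ellG ellG' V'(2)] unfolding g_def by blast
  have 2: "(\<Sum>x\<in>A. wt V adj g x) = (\<Sum>x\<in>adm V' x' V adj g. wt V adj g x)"
    using h(3) by (intro sum.mono_neutral_left) (auto simp: A_def)
  \<comment> \<open>Once only \<open>V'\<close> is left, all coordinates are prescribed. A nonempty
    fibre then makes \<open>x'\<close> itself admissible for \<open>h\<close>, so the reduced sum
    has exactly one term.\<close>
  have "adm V' x' V' adj h \<subseteq> {x'}"
    using x'(1) by (auto simp: adm_def supported_def fun_eq_iff) metis
  moreover have "adm V' x' V' adj h \<noteq> {}" using h(2) ne by (auto simp: A_def)
  ultimately have 3: "adm V' x' V' adj h = {x'}" by blast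
  have "wt V' adj h x' = wt V' adj g x'"
    unfolding wt_def
  proof (intro prod.cong refl)
    fix v assume v: "v \<in> V'"
    show "bcoeff (int (valency V' adj v) - 2) (nat (idx V' adj h x' v))
        = bcoeff (int (valency V' adj v) - 2) (nat (idx V' adj g x' v))"
    proof (cases "\<exists>u\<in>V-V'. adj v u")
      case True
      \<comment> \<open>At a boundary vertex both factors are coefficients of 1/(1 - t), hence 1
        whatever the values of \<open>h\<close> and \<open>g\<close> there.\<close>
      then have "int (valency V' adj v) - 2 = -1" using bdry v by simp
      then show ?thesis by simp
    next
      case False
      then show ?thesis using h(1) v idx_cong[of V' x' x' v h g adj] by simp
    qed
  qed
  then show ?thesis using 1 2 3 h(4) w'(2) by simp
qed

end
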